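(* There is a polynomial-time $\frac{e-1}{(2e+o(1))\,p\ln p}$-approximation algorithm for SRAMF, where $e$ is Euler's number, $p$ is one plus the maximum vehicle capacity, and $o(1)$ denotes a quantity depending only on $p$ that tends to $0$ as $p\to\infty$. That is, the algorithm outputs in polynomial time a set $S_R\subseteq S_A$ with $|S_R|\le K$ and, for each scenario $\xi$, a collection $M_\xi\subseteq E(\xi)$ of pairwise disjoint hyperedges, none of which contains a vehicle of $S_A\setminus S_R$, such that $$\frac1N\sum_{\xi}\sum_{f\in M_\xi} v_f\ \ge\ \frac{e-1}{(2e+o(1))\,p\ln p}\cdot \max_{S\subseteq S_A:\ |S|\le K} v^*(S).$$
   Context: SRAMF (Stochastic Ride-pooling Assignment with Mixed Fleets), in sample-average form. An instance consists of: disjoint finite sets of vehicles $S_A$ (augmented supply) and $S_B$ (basis supply); a capacity $C_i\ge 1$ for each vehicle $i$; a budget $K$; and $N$ equally weighted scenarios $\xi$. Each scenario $\xi$ has a finite set $D(\xi)$ of ride-requests and an explicitly listed finite set $E(\xi)$ of hyperedges. Each request has a positive integer number of passengers. Each hyperedge $f\in E(\xi)$ consists of exactly one vehicle $i\in S_A\cup S_B$ and a nonempty set of requests from $D(\xi)$ whose total number of passengers is at most $C_i$, and it has a value $v_f> 0$. Put $p=1+\max_{i\in S_A\cup S_B}C_i$; so every hyperedge has at most $p$ elements. Hyperedge sets of different scenarios are regarded as disjoint. For $S\subseteq S_A$, $v(S,\xi)$ is the maximum of $\sum_{f\in M}v_f$ over collections $M\subseteq E(\xi)$ of pairwise disjoint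 hyperedges none of which contains a vehicle of $S_A\setminus S$, and $v^*(S)=\frac1N\sum_\xi v(S,\xi)$. SRAMF asks to choose $S_R\subseteq S_A$ with $|S_R|\le K$ and an assignment in each scenario so as to maximize the average assignment value. Polynomial time means polynomial in the size of the instance. *)

theory Defs
  imports Complex_Main "HOL-Computational_Algebra.Polynomial"
begin

section \<open>SRAMF instances\<close>

text \<open>
  Vehicles and requests are named by natural numbers, in separate name spaces. A hyperedge is the
  pair of its vehicle and its set of requests. The scenarios form a list, so hyperedges of different
  scenarios are kept apart by the position of their scenario.
\<close>

type_synonym hyperedge = "nat \<times> nat set"

record scenario =
  requests :: "nat set"
  passengers :: "nat \<Rightarrow> nat"
  hyperedges :: "hyperedge set"
  val :: "hyperedge \<Rightarrow> rat"

record sramf =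
  augmented :: "nat set"
  basis :: "nat set"
  capacity :: "nat \<Rightarrow> nat"
  budget :: nat
  scenarios :: "scenario list"

definition vehicles :: "sramf \<Rightarrow> nat set" where
  "vehicles I = augmented I \<union> basis I"

definition wf_scenario :: "sramf \<Rightarrow> scenario \<Rightarrow> bool" where
  "wf_scenario I \<xi> \<longleftrightarrow>
     finite (requests \<xi>) \<and> (\<forall>r\<in>requests \<xi>. passengers \<xi> r \<ge> 1) \<and>
     finite (hyperedges \<xi>) \<and>
     (\<forall>(i, R)\<in>hyperedges \<xi>.
        i \<in> vehicles I \<and> R \<noteq> {} \<and> R \<subseteq> requests \<xi> \<and>
        (\<Sum>r\<in>R. passengers \<xi> r) \<le> capacity I i \<and> val \<xi> (i, R) > 0)"

text \<open>
  There is at least one vehicle and at least one scenario, because the definition of \<open>p\<close> takes a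
  maximum over the vehicles and the objective is an average over the scenarios.
\<close>

definition wf_sramf :: "sramf \<Rightarrow> bool" where
  "wf_sramf I \<longleftrightarrow>
     finite (augmented I) \<and> finite (basis I) \<and> augmented I \<inter> basis I = {} \<and>
     vehicles I \<noteq> {} \<and> (\<forall>i\<in>vehicles I. capacity I i \<ge> 1) \<and>
     scenarios I \<noteq> [] \<and> (\<forall>\<xi>\<in>set (scenarios I). wf_scenario I \<xi>)"

definition edge_bound :: "sramf \<Rightarrow> nat" where
  "edge_bound I = 1 + Max (capacity I ` vehicles I)"

definition disjoint_edges :: "hyperedge \<Rightarrow> hyperedge \<Rightarrow> bool" where
  "disjoint_edges f g \<longleftrightarrow> fst f \<noteq> fst g \<and> snd f \<inter> snd g = {}"

definition assignments :: "sramf \<Rightarrow> nat set \<Rightarrow> scenario \<Rightarrow> hyperedge set set" where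
  "assignments I S \<xi> =
     {M. M \<subseteq> hyperedges \<xi> \<and> pairwise disjoint_edges M \<and>
         (\<forall>f\<in>M. fst f \<notin> augmented I - S)}"

definition total_value :: "scenario \<Rightarrow> hyperedge set \<Rightarrow> real" where
  "total_value \<xi> M = (\<Sum>f\<in>M. of_rat (val \<xi> f))"

definition scenario_opt :: "sramf \<Rightarrow> nat set \<Rightarrow> scenario \<Rightarrow> real" where
  "scenario_opt I S \<xi> = Max (total_value \<xi> ` assignments I S \<xi>)"

definition average_opt :: "sramf \<Rightarrow> nat set \<Rightarrow> real" where
  "average_opt I S =
     (1 / real (length (scenarios I))) *
     (\<Sum>k<length (scenarios I). scenario_opt I S (scenarios I ! k))"

definition sramf_opt :: "sramf \<Rightarrow> real" where
  "sramf_opt I = Max (average_opt I ` {S. S \<subseteq> augmented I \<and> card S \<le> budget I})"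

text \<open>\<open>Ms ! k\<close> is the assignment chosen in the \<open>k\<close>-th scenario.\<close>

definition feasible_solution :: "sramf \<Rightarrow> nat set \<Rightarrow> hyperedge set list \<Rightarrow> bool" where
  "feasible_solution I S Ms \<longleftrightarrow>
     S \<subseteq> augmented I \<and> card S \<le> budget I \<and>
     length Ms = length (scenarios I) \<and>
     (\<forall>k<length (scenarios I). Ms ! k \<in> assignments I S (scenarios I ! k))"

definition solution_value :: "sramf \<Rightarrow> hyperedge set list \<Rightarrow> real" where
  "solution_value I Ms =
     (1 / real (length (scenarios I))) *
     (\<Sum>k<length (scenarios I). total_value (scenarios I ! k) (Ms ! k))"


section \<open>Machine model\<close>

text \<open>
  Algorithms are programs of the WHILE language of N. D. Jones, whose data are binary trees. An
  assignment is charged the size of the tree it stores, rather than one unit. The trees held in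
  the variables are therefore never larger than the input size plus the elapsed time, and a program
  has a fixed number of expressions of fixed length, so running times agree with those of Turing
  machines up to a polynomial. The function \<open>size\<close> on trees is the one generated by the
  datatype command: the number of \<open>Node\<close> constructors.
\<close>

datatype dat = Leaf | Node dat dat

datatype expr = Var nat | LeafE | NodeE expr expr | Left expr | Right expr

datatype prog =
    Skip
  | Assign nat expr
  | Seq prog prog
  | Cond expr prog prog
  | While expr prog

type_synonym store = "nat \<Rightarrow> dat"

fun left :: "dat \<Rightarrow> dat" where
  "left Leaf = Leaf"
| "left (Node a b) = a"

fun right :: "dat \<Rightarrow> dat" where
  "right Leaf = Leaf"
| "right (Node a b) = b"

primrec eval_expr :: "expr \<Rightarrow> store \<Rightarrow> dat" where
  "eval_expr (Var x) s = s x"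
| "eval_expr LeafE s = Leaf"
| "eval_expr (NodeE a b) s = Node (eval_expr a s) (eval_expr b s)"
| "eval_expr (Left a) s = left (eval_expr a s)"
| "eval_expr (Right a) s = right (eval_expr a s)"

text \<open>\<open>exec c s n s'\<close>: program \<open>c\<close> started in store \<open>s\<close> halts in store \<open>s'\<close> after time \<open>n\<close>.\<close>

inductive exec :: "prog \<Rightarrow> store \<Rightarrow> nat \<Rightarrow> store \<Rightarrow> bool" where
  Skip: "exec Skip s 1 s"
| Assign: "exec (Assign x a) s (1 + size (eval_expr a s)) (s(x := eval_expr a s))"
| Seq: "exec c s m s' \<Longrightarrow> exec d s' n s'' \<Longrightarrow> exec (Seq c d) s (m + n) s''"
| CondTrue: "eval_expr a s \<noteq> Leaf \<Longrightarrow> exec c s n s' \<Longrightarrow> exec (Cond a c d) s (1 + n) s'"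
| CondFalse: "eval_expr a s = Leaf \<Longrightarrow> exec d s n s' \<Longrightarrow> exec (Cond a c d) s (1 + n) s'"
| WhileFalse: "eval_expr a s = Leaf \<Longrightarrow> exec (While a c) s 1 s"
| WhileTrue: "eval_expr a s \<noteq> Leaf \<Longrightarrow> exec c s m s' \<Longrightarrow> exec (While a c) s' n s'' \<Longrightarrow>
    exec (While a c) s (1 + m + n) s''"

text \<open>Input and output are held in variable 0; all other variables start as \<open>Leaf\<close>.\<close>

definition runs :: "prog \<Rightarrow> dat \<Rightarrow> nat \<Rightarrow> dat \<Rightarrow> bool" where
  "runs c inp n out \<longleftrightarrow> (\<exists>s. exec c ((\<lambda>_. Leaf)(0 := inp)) n s \<and> s 0 = out)"


section \<open>Encoding of instances and solutions\<close>

text \<open>Numbers are written in binary, least significant bit first, without leading zeros.\<close>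

fun nat_dat :: "nat \<Rightarrow> dat" where
  "nat_dat n =
     (if n = 0 then Leaf
      else Node (if even n then Leaf else Node Leaf Leaf) (nat_dat (n div 2)))"

declare nat_dat.simps [simp del]

text \<open>Only used for \<open>q > 0\<close>: reduced numerator and denominator.\<close>

definition rat_dat :: "rat \<Rightarrow> dat" where
  "rat_dat q = Node (nat_dat (nat (fst (quotient_of q)))) (nat_dat (nat (snd (quotient_of q))))"

primrec list_dat :: "dat list \<Rightarrow> dat" where
  "list_dat [] = Leaf"
| "list_dat (t # ts) = Node t (list_dat ts)"

text \<open>
  A finite set is given by listing its elements without repetition in an arbitrary order, so encoding
  is a relation; an algorithm has to cope with every encoding of its input.
\<close>

definition set_code :: "('a \<Rightarrow> dat \<Rightarrow> bool) \<Rightarrow> 'a set \<Rightarrow> dat \<Rightarrow> bool" where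
  "set_code P A t \<longleftrightarrow>
     (\<exists>xs ts. distinct xs \<and> set xs = A \<and> list_all2 P xs ts \<and> t = list_dat ts)"

definition list_code :: "('a \<Rightarrow> dat \<Rightarrow> bool) \<Rightarrow> 'a list \<Rightarrow> dat \<Rightarrow> bool" where
  "list_code P xs t \<longleftrightarrow> (\<exists>ts. list_all2 P xs ts \<and> t = list_dat ts)"

definition nat_code :: "nat \<Rightarrow> dat \<Rightarrow> bool" where
  "nat_code n t \<longleftrightarrow> t = nat_dat n"

definition edge_code :: "hyperedge \<Rightarrow> dat \<Rightarrow> bool" where
  "edge_code f t \<longleftrightarrow> (\<exists>u. set_code nat_code (snd f) u \<and> t = Node (nat_dat (fst f)) u)"

definition labelled_nat_code :: "(nat \<Rightarrow> nat) \<Rightarrow> nat \<Rightarrow> dat \<Rightarrow> bool" where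
  "labelled_nat_code w n t \<longleftrightarrow> t = Node (nat_dat n) (nat_dat (w n))"

definition valued_edge_code :: "(hyperedge \<Rightarrow> rat) \<Rightarrow> hyperedge \<Rightarrow> dat \<Rightarrow> bool" where
  "valued_edge_code v f t \<longleftrightarrow> (\<exists>u. edge_code f u \<and> t = Node u (rat_dat (v f)))"

definition scenario_code :: "scenario \<Rightarrow> dat \<Rightarrow> bool" where
  "scenario_code \<xi> t \<longleftrightarrow>
     (\<exists>d e. set_code (labelled_nat_code (passengers \<xi>)) (requests \<xi>) d \<and>
            set_code (valued_edge_code (val \<xi>)) (hyperedges \<xi>) e \<and>
            t = Node d e)"

definition sramf_code :: "sramf \<Rightarrow> dat \<Rightarrow> bool" where
  "sramf_code I t \<longleftrightarrow>
     (\<exists>a b x. set_code (labelled_nat_code (capacity I)) (augmented I) a \<and>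
              set_code (labelled_nat_code (capacity I)) (basis I) b \<and>
              list_code scenario_code (scenarios I) x \<and>
              t = Node a (Node b (Node (nat_dat (budget I)) x)))"

definition solution_code :: "nat set \<Rightarrow> hyperedge set list \<Rightarrow> dat \<Rightarrow> bool" where
  "solution_code S Ms t \<longleftrightarrow>
     (\<exists>a x. set_code nat_code S a \<and> list_code (set_code edge_code) Ms x \<and> t = Node a x)"


section \<open>Polynomial-time approximation algorithms\<close>

definition polytime_approximation :: "prog \<Rightarrow> (sramf \<Rightarrow> real) \<Rightarrow> bool" where
  "polytime_approximation c \<rho> \<longleftrightarrow>
     (\<exists>q :: nat poly. \<forall>I t. wf_sramf I \<longrightarrow> sramf_code I t \<longrightarrow>
        (\<exists>n out S Ms.
           runs c t n out \<and> n \<le> poly q (size t) \<and> solution_code S Ms out \<and>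
           feasible_solution I S Ms \<and> solution_value I Ms \<ge> \<rho> I * sramf_opt I))"

end

theory Submission
  imports Defs
begin

text \<open>
  Since \<open>ln p \<longrightarrow> \<infinity>\<close>, any approximation ratio of the form \<open>1 / (c * p)\<close> with a constant \<open>c\<close> is good
  enough. Such a ratio is achieved by a greedy algorithm. Hyperedges are processed one at a time, and
  a hyperedge replaces the conflicting ones among those currently held if it is worth at least twice
  their total; hence the edges ever inserted are worth at most twice the edges held at the end. First
  all hyperedges of basis vehicles are processed, and then, \<open>K\<close> times, those of the augmented
  vehicle with the largest resulting total. Each inserted edge meets at most \<open>p\<close> edges of the optimum,
  so the part of the optimum served by selected vehicles is at most \<open>4 * p\<close> times the value \<open>V\<close> found.
  For the other part \<open>Q\<close>, the greedy choice gains at least \<open>(Q / 4 - p * V / 2) / K\<close> per round, so that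
  \<open>Q \<le> 4 * p * V\<close> as well. Replacing values by powers of two within a factor of two avoids rational
  arithmetic and costs another factor of four.

  Polynomial running time is obtained from closure properties of the class of functions computed by
  polynomial-time programs, the essential one being iteration along a list.
\<close>

section \<open>Polynomial-time computable functions on trees\<close>

text \<open>Evaluating the optimum of a scenario is weighted set packing, so the greedy choice does
  not compare optimal values. It compares the weights of the packings built by the insertion rule,
  and no submodularity of that weight is used. Its substitute is that adding a vehicle continues the
  same run: a trial insertion of a missed vehicle bounds its optimal edges by their conflicts with
  the edges held plus the gain of the trial. The loss term carries the factor p but the gain term
  does not, since the optimum has at most one edge of a given vehicle in the scenario of an inserted
  edge. Tagging edges with their scenario merges all scenarios into one packing problem, so one run
  serves the average objective. On the machine side, iterating a polynomial-time step may blow up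
  the data exponentially. Every iteration rule therefore asks for a bound on the accumulator, and
  all loops run along lists: the budget, being written in binary, could be exponential in the input
  size.\<close>

definition pbounded :: "(nat \<Rightarrow> nat) \<Rightarrow> bool" where
  "pbounded b \<longleftrightarrow> mono b \<and> (\<exists>q :: nat poly. \<forall>n. b n \<le> poly q n)"

lemma poly_nat_mono: "x \<le> y \<Longrightarrow> poly (q :: nat poly) x \<le> poly q y"
  by (induction q) (auto intro!: add_mono mult_mono)

lemma pbounded_const: "pbounded (\<lambda>_. c)"
  unfolding pbounded_def by (auto simp: mono_def intro!: exI[of _ "[:c:]"])

lemma pbounded_id: "pbounded (\<lambda>n. n)"
  unfolding pbounded_def by (auto simp: mono_def intro!: exI[of _ "[:0, 1:]"])

lemma pbounded_add:
  assumes "pbounded f" "pbounded g" shows "pbounded (\<lambda>n. f n + g n)"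
proof -
  obtain p q where "\<And>n. f n \<le> poly p n" "\<And>n. g n \<le> poly q n"
    using assms unfolding pbounded_def by blast
  then have "\<forall>n. f n + g n \<le> poly (p + q) n" by (simp add: add_mono)
  then show ?thesis using assms unfolding pbounded_def
    by (auto simp: mono_def add_mono intro: exI[of _ "p + q"])
qed

lemma pbounded_mult:
  assumes "pbounded f" "pbounded g" shows "pbounded (\<lambda>n. f n * g n)"
proof -
  obtain p q where "\<And>n. f n \<le> poly p n" "\<And>n. g n \<le> poly q n"
    using assms unfolding pbounded_def by blast
  then have "\<forall>n. f n * g n \<le> poly (p * q) n" by (simp add: mult_mono)
  then show ?thesis using assms unfolding pbounded_def
    by (auto simp: mono_def mult_mono intro: exI[of _ "p * q"])
qed

lemma pbounded_Suc: "pbounded f \<Longrightarrow> pbounded (\<lambda>n. Suc (f n))"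
  using pbounded_add[OF _ pbounded_const[of 1]] by simp

lemma pbounded_comp:
  assumes "pbounded f" "pbounded g" shows "pbounded (\<lambda>n. f (g n))"
proof -
  obtain p q where pq: "\<And>n. f n \<le> poly p n" "\<And>n. g n \<le> poly q n"
    using assms unfolding pbounded_def by blast
  have "f (g n) \<le> poly (pcompose p q) n" for n
    using order_trans[OF pq(1) poly_nat_mono[OF pq(2)]] by (simp add: poly_pcompose)
  then show ?thesis using assms unfolding pbounded_def
    by (auto simp: mono_def intro: exI[of _ "pcompose p q"])
qed

lemmas pbounded_intros = pbounded_const pbounded_id pbounded_add pbounded_mult pbounded_Suc

text \<open>Sizes of intermediate results are known only through upper estimates, and a running time
  has to be evaluated at such an estimate; this is why \<open>pbounded\<close> includes
  monotonicity.\<close>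

lemma pbounded_mono: "pbounded b \<Longrightarrow> x \<le> y \<Longrightarrow> b x \<le> b y"
  by (auto simp: pbounded_def mono_def)

text \<open>
  The program may be chosen to leave the variables \<open>1, \<dots>, k\<close> alone for any given \<open>k\<close>; this is what
  makes programs composable. It also must not depend on the initial values of its own variables.
\<close>

definition PT :: "(dat \<Rightarrow> dat) \<Rightarrow> bool" where
  "PT f \<longleftrightarrow> (\<exists>b. pbounded b \<and> (\<forall>k. \<exists>c. \<forall>s. \<exists>n s'.
     exec c s n s' \<and> n \<le> b (size (s 0)) \<and> s' 0 = f (s 0) \<and> (\<forall>j\<in>{1..k}. s' j = s j)))"

text \<open>An assignment is charged the size of the tree that it stores, so every tree in the store
  has either been there from the start or been paid for.\<close>

lemma exec_size: "exec c s n s' \<Longrightarrow> size (s' v) \<le> size (s v) + n"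
  by (induction rule: exec.induct) auto

lemma PT_size:
  assumes "PT f" obtains b where "pbounded b" "\<And>x. size (f x) \<le> b (size x)"
proof -
  obtain b where b: "pbounded b" and "\<forall>k. \<exists>c. \<forall>s. \<exists>n s'.
     exec c s n s' \<and> n \<le> b (size (s 0)) \<and> s' 0 = f (s 0) \<and> (\<forall>j\<in>{1..k}. s' j = s j)"
    using assms unfolding PT_def by blast
  then obtain c where c: "\<And>s. \<exists>n s'. exec c s n s' \<and> n \<le> b (size (s 0)) \<and> s' 0 = f (s 0)"
    by metis
  have "size (f x) \<le> size x + b (size x)" for x
    using c[of "\<lambda>_. x"] exec_size[of c "\<lambda>_. x" _ _ 0] by fastforce
  then show ?thesis using that[OF pbounded_add[OF pbounded_id b]] by blast
qed

lemma PT_expr: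
  assumes "\<And>s. eval_expr a s = f (s 0)" "pbounded b" "\<And>x. size (f x) \<le> b (size x)"
  shows "PT f"
  unfolding PT_def
proof (intro exI[of _ "\<lambda>n. 1 + b n"] conjI allI)
  show "pbounded (\<lambda>n. 1 + b n)" by (intro pbounded_intros assms)
  fix k
  show "\<exists>c. \<forall>s. \<exists>n s'. exec c s n s' \<and> n \<le> 1 + b (size (s 0)) \<and> s' 0 = f (s 0) \<and>
      (\<forall>j\<in>{1..k}. s' j = s j)"
    by (rule exI[of _ "Assign 0 a"]) (auto intro!: exI exec.Assign simp: assms)
qed

lemma size_left: "size (left x) \<le> size x" and size_right: "size (right x) \<le> size x"
  by (cases x; simp)+

lemma PT_id: "PT (\<lambda>x. x)"
  by (rule PT_expr[of "Var 0" _ "\<lambda>n. n"]) (auto intro: pbounded_intros)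

lemma PT_Leaf: "PT (\<lambda>_. Leaf)"
  by (rule PT_expr[of "LeafE" _ "\<lambda>n. n"]) (auto intro: pbounded_intros)

lemma PT_comp:
  assumes "PT g" "PT f" shows "PT (\<lambda>x. g (f x))"
proof -
  obtain b1 where b1: "pbounded b1" and g: "\<forall>k. \<exists>c. \<forall>s. \<exists>n s'.
     exec c s n s' \<and> n \<le> b1 (size (s 0)) \<and> s' 0 = g (s 0) \<and> (\<forall>j\<in>{1..k}. s' j = s j)"
    using assms unfolding PT_def by blast
  obtain b2 where b2: "pbounded b2" and f: "\<forall>k. \<exists>c. \<forall>s. \<exists>n s'.
     exec c s n s' \<and> n \<le> b2 (size (s 0)) \<and> s' 0 = f (s 0) \<and> (\<forall>j\<in>{1..k}. s' j = s j)"
    using assms unfolding PT_def by blast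
  obtain d where d: "pbounded d" "\<And>x. size (f x) \<le> d (size x)" using PT_size assms by blast
  have "pbounded (\<lambda>n. b2 n + b1 (d n))" by (intro pbounded_intros pbounded_comp[OF b1] b2 d)
  moreover have "\<exists>c. \<forall>s. \<exists>n s'. exec c s n s' \<and> n \<le> b2 (size (s 0)) + b1 (d (size (s 0))) \<and>
     s' 0 = g (f (s 0)) \<and> (\<forall>j\<in>{1..k}. s' j = s j)" for k
  proof -
    obtain cg where cg: "\<And>s. \<exists>n s'. exec cg s n s' \<and> n \<le> b1 (size (s 0)) \<and>
       s' 0 = g (s 0) \<and> (\<forall>j\<in>{1..k}. s' j = s j)" using g by blast
    obtain cf where cf: "\<And>s. \<exists>n s'. exec cf s n s' \<and> n \<le> b2 (size (s 0)) \<and>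
       s' 0 = f (s 0) \<and> (\<forall>j\<in>{1..k}. s' j = s j)" using f by blast
    show ?thesis
    proof (intro exI[of _ "Seq cf cg"] allI)
      fix s :: store
      obtain n s' where 1: "exec cf s n s'" "n \<le> b2 (size (s 0))" "s' 0 = f (s 0)"
        "\<forall>j\<in>{1..k}. s' j = s j" using cf by blast
      obtain m s'' where 2: "exec cg s' m s''" "m \<le> b1 (size (s' 0))" "s'' 0 = g (s' 0)"
        "\<forall>j\<in>{1..k}. s'' j = s' j" using cg by blast
      have "m \<le> b1 (d (size (s 0)))"
        using 2(2) 1(3) pbounded_mono[OF b1 d(2)[of "s 0"]] by simp
      then show "\<exists>n s'. exec (Seq cf cg) s n s' \<and> n \<le> b2 (size (s 0)) + b1 (d (size (s 0))) \<and>
        s' 0 = g (f (s 0)) \<and> (\<forall>j\<in>{1..k}. s' j = s j)"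
        using 1 2 by (intro exI[of _ "n + m"] exI[of _ s'']) (auto intro: exec.Seq)
    qed
  qed
  ultimately show ?thesis unfolding PT_def by blast
qed

lemma PT_left: "PT f \<Longrightarrow> PT (\<lambda>x. left (f x))"
  by (rule PT_comp[of left], rule PT_expr[of "Left (Var 0)" _ "\<lambda>n. n"])
    (auto intro: pbounded_intros size_left)

lemma PT_right: "PT f \<Longrightarrow> PT (\<lambda>x. right (f x))"
  by (rule PT_comp[of right], rule PT_expr[of "Right (Var 0)" _ "\<lambda>n. n"])
    (auto intro: pbounded_intros size_right)

text \<open>The program for \<open>g\<close> needs the original input after that for
  \<open>f\<close> has overwritten variable 0. The input is parked in \<open>k+1\<close> and the
  value of \<open>f\<close> in \<open>k+2\<close>, so both subprograms are taken in a version that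
  preserves the variables up to \<open>k+2\<close>.\<close>

lemma PT_Node:
  assumes "PT f" "PT g" shows "PT (\<lambda>x. Node (f x) (g x))"
proof -
  obtain b1 where b1: "pbounded b1" and g: "\<forall>k. \<exists>c. \<forall>s. \<exists>n s'.
     exec c s n s' \<and> n \<le> b1 (size (s 0)) \<and> s' 0 = g (s 0) \<and> (\<forall>j\<in>{1..k}. s' j = s j)"
    using assms unfolding PT_def by blast
  obtain b2 where b2: "pbounded b2" and f: "\<forall>k. \<exists>c. \<forall>s. \<exists>n s'.
     exec c s n s' \<and> n \<le> b2 (size (s 0)) \<and> s' 0 = f (s 0) \<and> (\<forall>j\<in>{1..k}. s' j = s j)"
    using assms unfolding PT_def by blast
  obtain d1 where d1: "pbounded d1" "\<And>x. size (f x) \<le> d1 (size x)" using PT_size assms by blast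
  obtain d2 where d2: "pbounded d2" "\<And>x. size (g x) \<le> d2 (size x)" using PT_size assms by blast
  let ?b = "\<lambda>n. n + b1 n + b2 n + n + d1 n + d1 n + d2 n + 6"
  have "pbounded ?b" by (intro pbounded_intros b1 b2 d1 d2)
  moreover have "\<exists>c. \<forall>s. \<exists>n s'. exec c s n s' \<and> n \<le> ?b (size (s 0)) \<and>
     s' 0 = Node (f (s 0)) (g (s 0)) \<and> (\<forall>j\<in>{1..k}. s' j = s j)" for k
  proof -
    obtain cg where cg: "\<And>s. \<exists>n s'. exec cg s n s' \<and> n \<le> b1 (size (s 0)) \<and>
       s' 0 = g (s 0) \<and> (\<forall>j\<in>{1..k+2}. s' j = s j)" using g by blast
    obtain cf where cf: "\<And>s. \<exists>n s'. exec cf s n s' \<and> n \<le> b2 (size (s 0)) \<and>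
       s' 0 = f (s 0) \<and> (\<forall>j\<in>{1..k+2}. s' j = s j)" using f by blast
    let ?c = "Seq (Assign (k+1) (Var 0)) (Seq cf (Seq (Assign (k+2) (Var 0))
      (Seq (Assign 0 (Var (k+1))) (Seq cg (Assign 0 (NodeE (Var (k+2)) (Var 0)))))))"
    show ?thesis
    proof (intro exI[of _ ?c] allI)
      fix s :: store
      let ?s1 = "s(k+1 := s 0)"
      obtain n s2 where 1: "exec cf ?s1 n s2" "n \<le> b2 (size (?s1 0))" "s2 0 = f (?s1 0)"
        "\<forall>j\<in>{1..k+2}. s2 j = ?s1 j" using cf by blast
      let ?s4 = "s2(k+2 := s2 0, 0 := s2 (k+1))"
      obtain m s5 where 2: "exec cg ?s4 m s5" "m \<le> b1 (size (?s4 0))" "s5 0 = g (?s4 0)"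
        "\<forall>j\<in>{1..k+2}. s5 j = ?s4 j" using cg by blast
      have a: "s2 (k+1) = s 0" "s5 (k+2) = f (s 0)" "s5 0 = g (s 0)" "s2 0 = f (s 0)" using 1 2 by auto
      let ?s6 = "s5(0 := Node (s5 (k+2)) (s5 0))"
      have e: "exec ?c s ((1 + size (s 0)) + (n + ((1 + size (s2 0)) + ((1 + size (s2 (k+1))) + (m +
         (1 + size (Node (s5 (k+2)) (s5 0)))))))) ?s6"
        using exec.Assign[of "k+1" "Var 0" s] exec.Assign[of "k+2" "Var 0" s2]
          exec.Assign[of 0 "Var (k+1)" "s2(k+2 := s2 0)"]
          exec.Assign[of 0 "NodeE (Var (k+2)) (Var 0)" s5]
        by (intro exec.Seq[OF _ exec.Seq[OF 1(1) exec.Seq[OF _ exec.Seq[OF _ exec.Seq[OF 2(1)]]]]])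
          simp_all
      have "\<forall>j\<in>{1..k}. ?s6 j = s j" using 1(4) 2(4) by auto
      moreover have "(1 + size (s 0)) + (n + ((1 + size (s2 0)) + ((1 + size (s2 (k+1))) + (m +
         (1 + size (Node (s5 (k+2)) (s5 0))))))) \<le> ?b (size (s 0))"
        using 1(2) 2(2) a d1(2)[of "s 0"] d2(2)[of "s 0"] by simp
      moreover have "?s6 0 = Node (f (s 0)) (g (s 0))" using a by simp
      ultimately show "\<exists>n s'. exec ?c s n s' \<and> n \<le> ?b (size (s 0)) \<and>
         s' 0 = Node (f (s 0)) (g (s 0)) \<and> (\<forall>j\<in>{1..k}. s' j = s j)"
        using e by blast
    qed
  qed
  ultimately show ?thesis unfolding PT_def by (intro exI[of _ ?b]) blast
qed

text \<open>\<open>Cond\<close> tests an expression, not a program. A computed truth value therefore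
  has to arrive paired with the argument; \<open>PT_if\<close> builds that pair.\<close>

lemma PT_case_left:
  assumes "PT f" "PT g"
  shows "PT (\<lambda>x. if left x \<noteq> Leaf then f (right x) else g (right x))"
proof -
  have fr: "PT (\<lambda>x. f (right x))" "PT (\<lambda>x. g (right x))"
    using assms by (auto intro!: PT_comp[of f] PT_comp[of g] PT_right PT_id)
  obtain b1 where b1: "pbounded b1" and g: "\<forall>k. \<exists>c. \<forall>s. \<exists>n s'.
     exec c s n s' \<and> n \<le> b1 (size (s 0)) \<and> s' 0 = g (right (s 0)) \<and> (\<forall>j\<in>{1..k}. s' j = s j)"
    using fr unfolding PT_def by blast
  obtain b2 where b2: "pbounded b2" and f: "\<forall>k. \<exists>c. \<forall>s. \<exists>n s'.
     exec c s n s' \<and> n \<le> b2 (size (s 0)) \<and> s' 0 = f (right (s 0)) \<and> (\<forall>j\<in>{1..k}. s' j = s j)"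
    using fr unfolding PT_def by blast
  let ?b = "\<lambda>n. 1 + b1 n + b2 n"
  have "pbounded ?b" by (intro pbounded_intros b1 b2)
  moreover have "\<exists>c. \<forall>s. \<exists>n s'. exec c s n s' \<and> n \<le> ?b (size (s 0)) \<and>
     s' 0 = (if left (s 0) \<noteq> Leaf then f (right (s 0)) else g (right (s 0))) \<and>
     (\<forall>j\<in>{1..k}. s' j = s j)" for k
  proof -
    obtain cg where cg: "\<And>s. \<exists>n s'. exec cg s n s' \<and> n \<le> b1 (size (s 0)) \<and>
       s' 0 = g (right (s 0)) \<and> (\<forall>j\<in>{1..k}. s' j = s j)" using g by blast
    obtain cf where cf: "\<And>s. \<exists>n s'. exec cf s n s' \<and> n \<le> b2 (size (s 0)) \<and>
       s' 0 = f (right (s 0)) \<and> (\<forall>j\<in>{1..k}. s' j = s j)" using f by blast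
    show ?thesis
    proof (intro exI[of _ "Cond (Left (Var 0)) cf cg"] allI)
      fix s :: store
      obtain n s1 where 1: "exec cf s n s1" "n \<le> b2 (size (s 0))" "s1 0 = f (right (s 0))"
        "\<forall>j\<in>{1..k}. s1 j = s j" using cf by blast
      obtain m s2 where 2: "exec cg s m s2" "m \<le> b1 (size (s 0))" "s2 0 = g (right (s 0))"
        "\<forall>j\<in>{1..k}. s2 j = s j" using cg by blast
      show "\<exists>n s'. exec (Cond (Left (Var 0)) cf cg) s n s' \<and> n \<le> ?b (size (s 0)) \<and>
         s' 0 = (if left (s 0) \<noteq> Leaf then f (right (s 0)) else g (right (s 0))) \<and>
         (\<forall>j\<in>{1..k}. s' j = s j)"
      proof (cases "left (s 0) = Leaf")
        case True
        then have "exec (Cond (Left (Var 0)) cf cg) s (1 + m) s2"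
          using 2 by (intro exec.CondFalse) auto
        then show ?thesis using True 2 by (intro exI[of _ "1 + m"] exI[of _ s2]) auto
      next
        case False
        then have "exec (Cond (Left (Var 0)) cf cg) s (1 + n) s1"
          using 1 by (intro exec.CondTrue) auto
        then show ?thesis using False 1 by (intro exI[of _ "1 + n"] exI[of _ s1]) auto
      qed
    qed
  qed
  ultimately show ?thesis unfolding PT_def by (intro exI[of _ ?b]) blast
qed

section \<open>Trees as lists and iteration along a list\<close>

fun els :: "dat \<Rightarrow> dat list" where
  "els Leaf = []"
| "els (Node a b) = a # els b"

text \<open>These are the values that a loop variable takes when it walks along the list. Folding
  over them, rather than over the elements, also tells how much of the list remains, which later
  numbers the scenarios.\<close>

fun suffixes :: "dat \<Rightarrow> dat list" where
  "suffixes Leaf = []"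
| "suffixes (Node a b) = Node a b # suffixes b"

lemma els_list_dat [simp]: "els (list_dat xs) = xs" by (induction xs) auto
lemma list_dat_els [simp]: "list_dat (els d) = d" by (induction d) auto

lemma length_suffixes: "length (suffixes l) \<le> size l" by (induction l) auto

text \<open>A \<open>While\<close> loop keeps parameter, accumulator and remaining list in three
  preserved variables and packs them into variable 0 for each call of the step. The number of rounds
  is at most the size of the list; \<open>bd\<close> bounds the accumulator after every prefix,
  without which the cost of the later rounds would be out of control.\<close>

lemma PT_foldl_suffixes_raw:
  assumes step: "PT (\<lambda>z. step (left z) (left (right z)) (right (right z)))"
    and B: "pbounded B"
    and i: "PT i"
    and bd: "\<And>x ys zs. suffixes (right (right (i x))) = ys @ zs \<Longrightarrow>
       size (foldl (step (left (i x))) (left (right (i x))) ys) \<le> B (size (i x))"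
  shows "PT (\<lambda>x. foldl (step (left (i x))) (left (right (i x))) (suffixes (right (right (i x)))))"
proof -
  obtain b1 where b1: "pbounded b1" and st: "\<forall>k. \<exists>c. \<forall>s. \<exists>n s'.
     exec c s n s' \<and> n \<le> b1 (size (s 0)) \<and>
     s' 0 = step (left (s 0)) (left (right (s 0))) (right (right (s 0))) \<and> (\<forall>j\<in>{1..k}. s' j = s j)"
    using step unfolding PT_def by blast
  obtain b2 where b2: "pbounded b2" and ci: "\<forall>k. \<exists>c. \<forall>s. \<exists>n s'.
     exec c s n s' \<and> n \<le> b2 (size (s 0)) \<and> s' 0 = i (s 0) \<and> (\<forall>j\<in>{1..k}. s' j = s j)"
    using i unfolding PT_def by blast
  obtain d where d: "pbounded d" "\<And>x. size (i x) \<le> d (size x)" using PT_size[OF i] by blast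
  \<comment> \<open>Cost of one round if parameter and list have size at most \<open>n\<close> and
    the accumulator at most \<open>B n\<close>: the packed triple has size at most
    \<open>2 + n + B n + n\<close>, and the remaining assignments store the new accumulator and the
    tail of the list.\<close>
  define T where "T n = 6 + 2 * (n + B n + n) + b1 (2 + n + B n + n)" for n
  have T: "pbounded T"
    unfolding T_def by (intro pbounded_intros pbounded_comp[OF b1] B)
  let ?b = "\<lambda>n. b2 n + (5 + d n + d n + d n + d n * T (d n) + B (d n))"
  have "pbounded ?b"
    by (intro pbounded_intros pbounded_comp[OF T] pbounded_comp[OF B] b2 d)
  moreover have "\<exists>c. \<forall>s. \<exists>n s'. exec c s n s' \<and> n \<le> ?b (size (s 0)) \<and>
     s' 0 = foldl (step (left (i (s 0)))) (left (right (i (s 0)))) (suffixes (right (right (i (s 0))))) \<and>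
     (\<forall>j\<in>{1..k}. s' j = s j)" for k
  proof -
    obtain cs where cs: "\<And>s. \<exists>n s'. exec cs s n s' \<and> n \<le> b1 (size (s 0)) \<and>
       s' 0 = step (left (s 0)) (left (right (s 0))) (right (right (s 0))) \<and>
       (\<forall>j\<in>{1..k+3}. s' j = s j)" using st by blast
    obtain c0 where c0: "\<And>s. \<exists>n s'. exec c0 s n s' \<and> n \<le> b2 (size (s 0)) \<and>
       s' 0 = i (s 0) \<and> (\<forall>j\<in>{1..k+3}. s' j = s j)" using ci by blast
    let ?body = "Seq (Assign 0 (NodeE (Var (k+1)) (NodeE (Var (k+2)) (Var (k+3)))))
       (Seq cs (Seq (Assign (k+2) (Var 0)) (Assign (k+3) (Right (Var (k+3))))))"
    let ?w = "While (Var (k+3)) ?body"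
    \<comment> \<open>The bound \<open>N\<close> is kept separate from the size of \<open>l\<close>,
      so that it stays fixed while the list shrinks in the induction.\<close>
    have loop: "\<exists>n s'. exec ?w s n s' \<and> n \<le> 1 + length (suffixes l) * T N \<and>
        s' (k+2) = foldl (step x) a (suffixes l) \<and> (\<forall>j\<in>{1..k}. s' j = s j)"
      if "s (k+1) = x" "s (k+2) = a" "s (k+3) = l" "size x \<le> N" "size l \<le> N"
        "\<And>ys zs. suffixes l = ys @ zs \<Longrightarrow> size (foldl (step x) a ys) \<le> B N" for s :: store and x a l N
      using that
    proof (induction l arbitrary: s a)
      case Leaf
      then have "exec ?w s 1 s" by (intro exec.WhileFalse) auto
      then show ?case using Leaf by (intro exI[of _ 1] exI[of _ s]) auto
    next
      case (Node h l)
      let ?s1 = "s(0 := Node x (Node a (Node h l)))"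
      obtain n s2 where 1: "exec cs ?s1 n s2" "n \<le> b1 (size (?s1 0))"
        "s2 0 = step x a (Node h l)" "\<forall>j\<in>{1..k+3}. s2 j = ?s1 j" using cs[of ?s1] by auto
      let ?s3 = "s2(k+2 := s2 0)"
      let ?s4 = "?s3(k+3 := right (s2 (k+3)))"
      have eq: "s2 (k+3) = Node h l" "s2 (k+1) = x" using 1(4) Node.prems by auto
      have "\<exists>n s'. exec ?w ?s4 n s' \<and> n \<le> 1 + length (suffixes l) * T N \<and>
        s' (k+2) = foldl (step x) (s2 0) (suffixes l) \<and> (\<forall>j\<in>{1..k}. s' j = ?s4 j)"
      proof (rule Node.IH(2))
        show "size (foldl (step x) (s2 0) ys) \<le> B N" if "suffixes l = ys @ zs" for ys zs
          using Node.prems(6)[of "Node h l # ys" zs] that 1(3) by simp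
      qed (use Node.prems eq in auto)
      then obtain m s5 where 2: "exec ?w ?s4 m s5" "m \<le> 1 + length (suffixes l) * T N"
        "s5 (k+2) = foldl (step x) (s2 0) (suffixes l)" "\<forall>j\<in>{1..k}. s5 j = ?s4 j" by blast
      let ?n = "1 + size (?s1 0) + (n + ((1 + size (s2 0)) + (1 + size (right (s2 (k+3))))))"
      have "exec ?body s ?n ?s4"
        using exec.Assign[of 0 "NodeE (Var (k+1)) (NodeE (Var (k+2)) (Var (k+3)))" s]
          exec.Assign[of "k+2" "Var 0" s2]
          exec.Assign[of "k+3" "Right (Var (k+3))" ?s3] Node.prems
        by (intro exec.Seq[OF _ exec.Seq[OF 1(1) exec.Seq]]) simp_all
      then have e: "exec ?w s (1 + ?n + m) s5"
        using 2(1) Node.prems by (intro exec.WhileTrue) auto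
      have sz: "size a \<le> B N" "size (s2 0) \<le> B N"
        using Node.prems(6)[of "[]" "suffixes (Node h l)"]
          Node.prems(6)[of "[Node h l]" "suffixes l"] 1(3) by auto
      have "size (?s1 0) \<le> 2 + N + B N + N" using Node.prems sz by simp
      moreover from this have "n \<le> b1 (2 + N + B N + N)"
        using 1(2) pbounded_mono[OF b1] order_trans by blast
      ultimately have "1 + ?n \<le> T N" unfolding T_def
        using sz eq Node.prems(5) by simp
      then have "1 + ?n + m \<le> 1 + length (suffixes (Node h l)) * T N" using 2(2) by simp
      moreover have "\<forall>j\<in>{1..k}. s5 j = s j" using 2(4) 1(4) by auto
      moreover have "s5 (k+2) = foldl (step x) a (suffixes (Node h l))" using 2(3) 1(3) by simp
      ultimately show ?case using e by blast
    qed
    let ?c = "Seq c0 (Seq (Assign (k+1) (Left (Var 0))) (Seq (Assign (k+2) (Left (Right (Var 0))))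
      (Seq (Assign (k+3) (Right (Right (Var 0)))) (Seq ?w (Assign 0 (Var (k+2)))))))"
    show ?thesis
    proof (intro exI[of _ ?c] allI)
      fix s :: store
      obtain n0 s0 where 0: "exec c0 s n0 s0" "n0 \<le> b2 (size (s 0))"
        "s0 0 = i (s 0)" "\<forall>j\<in>{1..k+3}. s0 j = s j" using c0 by blast
      let ?z = "i (s 0)"
      let ?l = "right (right ?z)"
      let ?s1 = "s0(k+1 := left ?z)"
      let ?s2 = "?s1(k+2 := left (right ?z))"
      let ?s3 = "?s2(k+3 := right (right ?z))"
      have "\<exists>n s'. exec ?w ?s3 n s' \<and> n \<le> 1 + length (suffixes ?l) * T (size ?z) \<and>
        s' (k+2) = foldl (step (left ?z)) (left (right ?z)) (suffixes ?l) \<and> (\<forall>j\<in>{1..k}. s' j = ?s3 j)"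
      proof (rule loop)
        show "size (foldl (step (left ?z)) (left (right ?z)) ys) \<le> B (size ?z)"
          if "suffixes ?l = ys @ zs" for ys zs using bd[OF that] .
      qed (auto intro: size_left order_trans[OF size_right size_right])
      then obtain m s4 where 1: "exec ?w ?s3 m s4" "m \<le> 1 + length (suffixes ?l) * T (size ?z)"
        "s4 (k+2) = foldl (step (left ?z)) (left (right ?z)) (suffixes ?l)" "\<forall>j\<in>{1..k}. s4 j = ?s3 j"
        by blast
      let ?s5 = "s4(0 := s4 (k+2))"
      let ?n = "n0 + ((1 + size (left ?z)) + ((1 + size (left (right ?z))) + ((1 + size ?l) +
         (m + (1 + size (s4 (k+2)))))))"
      have "exec ?c s ?n ?s5"
        using 0 exec.Assign[of "k+1" "Left (Var 0)" s0] exec.Assign[of "k+2" "Left (Right (Var 0))" ?s1]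
          exec.Assign[of "k+3" "Right (Right (Var 0))" ?s2]
          exec.Assign[of 0 "Var (k+2)" s4]
        by (intro exec.Seq[OF 0(1) exec.Seq[OF _ exec.Seq[OF _ exec.Seq[OF _ exec.Seq[OF 1(1)]]]]])
          simp_all
      moreover have "?n \<le> ?b (size (s 0))"
      proof -
        have dz: "size ?z \<le> d (size (s 0))" by (rule d)
        have "size (s4 (k+2)) \<le> B (size ?z)" using bd[of "s 0" "suffixes ?l" "[]"] 1(3) by simp
        also have "\<dots> \<le> B (d (size (s 0)))" by (rule pbounded_mono[OF B dz])
        finally have A1: "size (s4 (k+2)) \<le> B (d (size (s 0)))" .
        have "length (suffixes ?l) \<le> d (size (s 0))"
          using length_suffixes[of ?l] size_right[of "right ?z"] size_right[of ?z] dz by linarith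
        then have "length (suffixes ?l) * T (size ?z) \<le> d (size (s 0)) * T (d (size (s 0)))"
          by (intro mult_mono pbounded_mono[OF T dz]) auto
        moreover have "size (left ?z) \<le> d (size (s 0))" "size (left (right ?z)) \<le> d (size (s 0))"
          "size ?l \<le> d (size (s 0))"
          using dz size_left[of ?z] size_left[of "right ?z"] size_right[of "right ?z"]
            size_right[of ?z] by linarith+
        ultimately show ?thesis using 0(2) 1(2) A1 by linarith
      qed
      moreover have "?s5 0 = foldl (step (left ?z)) (left (right ?z)) (suffixes ?l)" using 1 by simp
      moreover have "\<forall>j\<in>{1..k}. ?s5 j = s j" using 1(4) 0(4) by auto
      ultimately show "\<exists>n s'. exec ?c s n s' \<and> n \<le> ?b (size (s 0)) \<and>
         s' 0 = foldl (step (left ?z)) (left (right ?z)) (suffixes ?l) \<and>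
         (\<forall>j\<in>{1..k}. s' j = s j)" by blast
    qed
  qed
  ultimately show ?thesis unfolding PT_def by (intro exI[of _ ?b]) blast
qed

section \<open>Functions with values in lists, numbers and truth values\<close>

definition PTL :: "(dat \<Rightarrow> dat list) \<Rightarrow> bool" where
  "PTL f \<longleftrightarrow> PT (\<lambda>x. list_dat (f x))"

definition PTN :: "(dat \<Rightarrow> nat) \<Rightarrow> bool" where
  "PTN f \<longleftrightarrow> PT (\<lambda>x. nat_dat (f x))"

definition bool_dat :: "bool \<Rightarrow> dat" where
  "bool_dat b = (if b then Node Leaf Leaf else Leaf)"

definition PTB :: "(dat \<Rightarrow> bool) \<Rightarrow> bool" where
  "PTB P \<longleftrightarrow> PT (\<lambda>x. bool_dat (P x))"

lemma bool_dat_simps [simp]: "bool_dat b = Leaf \<longleftrightarrow> \<not> b" "size (bool_dat b) \<le> 1"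
  by (auto simp: bool_dat_def)

lemma PT_if:
  assumes "PTB P" "PT f" "PT g" shows "PT (\<lambda>x. if P x then f x else g x)"
  using PT_comp[OF PT_case_left[OF assms(2,3)] PT_Node[OF assms(1)[unfolded PTB_def] PT_id]]
  by (simp cong: if_cong)

lemma PT_const: "PT (\<lambda>_. d)"
  by (induction d) (auto intro: PT_Leaf PT_Node)

lemma PTB_const: "PTB (\<lambda>_. b)"
  unfolding PTB_def by (rule PT_const)

lemma PTB_if:
  assumes "PTB P" "PTB Q" "PTB R" shows "PTB (\<lambda>x. if P x then Q x else R x)"
  using PT_if[OF assms(1) assms(2,3)[unfolded PTB_def]] unfolding PTB_def by (simp add: if_distrib[of bool_dat])

lemma PTB_not:
  assumes "PTB P" shows "PTB (\<lambda>x. \<not> P x)"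
proof -
  have "(\<lambda>x. \<not> P x) = (\<lambda>x. if P x then False else True)" by auto
  then show ?thesis using assms by (simp only: PTB_if PTB_const)
qed

lemma PTB_conj:
  assumes "PTB P" "PTB Q" shows "PTB (\<lambda>x. P x \<and> Q x)"
proof -
  have "(\<lambda>x. P x \<and> Q x) = (\<lambda>x. if P x then Q x else False)" by auto
  then show ?thesis using assms by (simp only: PTB_if PTB_const)
qed

lemma PTB_disj:
  assumes "PTB P" "PTB Q" shows "PTB (\<lambda>x. P x \<or> Q x)"
proof -
  have "(\<lambda>x. P x \<or> Q x) = (\<lambda>x. if P x then True else Q x)" by auto
  then show ?thesis using assms by (simp only: PTB_if PTB_const)
qed

lemma PTB_iff:
  assumes "PTB P" "PTB Q" shows "PTB (\<lambda>x. P x = Q x)"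
proof -
  have "(\<lambda>x. P x = Q x) = (\<lambda>x. if P x then Q x else \<not> Q x)" by auto
  then show ?thesis using PTB_if[OF assms PTB_not[OF assms(2)]] by simp
qed

lemma PTB_neq_Leaf: "PT f \<Longrightarrow> PTB (\<lambda>x. f x \<noteq> Leaf)"
  unfolding PTB_def bool_dat_def
  using PT_comp[OF PT_case_left[OF PT_const PT_Leaf] PT_Node[OF _ PT_Leaf]] by simp

lemma PTB_eq_Leaf: "PT f \<Longrightarrow> PTB (\<lambda>x. f x = Leaf)"
  using PTB_not[OF PTB_neq_Leaf] by simp

lemma PT_bool_dat: "PTB P \<Longrightarrow> PT (\<lambda>x. bool_dat (P x))"
  by (simp add: PTB_def)

lemma els_suffixes: "els l = map left (suffixes l)"
  by (induction l) auto

lemma size_suffix: "s \<in> set (suffixes l) \<Longrightarrow> size s \<le> size l"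
  by (induction l) auto

lemma size_list_dat: "size (list_dat xs) = (\<Sum>a\<leftarrow>xs. size a + 1)"
  by (induction xs) auto

lemma size_els: "a \<in> set (els l) \<Longrightarrow> size a \<le> size l"
  by (induction l) auto

lemma size_foldl_additive:
  assumes "\<And>acc a. a \<in> set ys \<Longrightarrow> size (f acc a) \<le> size acc + (c :: nat)"
  shows "size (foldl f i ys) \<le> size i + length ys * c"
  using assms
proof (induction ys arbitrary: i)
  case (Cons y ys)
  have "size (foldl f (f i y) ys) \<le> size (f i y) + length ys * c" using Cons by simp
  then show ?case using Cons.prems[of y i] by simp
qed simp

lemma PT_foldl_suffixes:
  assumes i: "PT i" and l: "PT l"
    and step: "PT (\<lambda>z. step (left z) (left (right z)) (right (right z)))"
    and B: "pbounded B"
    and bd: "\<And>x ys zs. suffixes (l x) = ys @ zs \<Longrightarrow> size (foldl (step x) (i x) ys) \<le> B (size x)"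
  shows "PT (\<lambda>x. foldl (step x) (i x) (suffixes (l x)))"
proof -
  have "PT (\<lambda>x. Node x (Node (i x) (l x)))" by (intro PT_Node PT_id i l)
  from PT_foldl_suffixes_raw[OF step B this] show ?thesis
    using bd order_trans[OF bd pbounded_mono[OF B]] by simp
qed

lemma PT_foldl_bounded:
  assumes i: "PT i" and l: "PTL l"
    and step: "PT (\<lambda>z. step (left z) (left (right z)) (right (right z)))"
    and B: "pbounded B"
    and bd: "\<And>x ys zs. l x = ys @ zs \<Longrightarrow> size (foldl (step x) (i x) ys) \<le> B (size x)"
  shows "PT (\<lambda>x. foldl (step x) (i x) (l x))"
proof -
  have *: "foldl (\<lambda>acc s. step x acc (left s)) a ys = foldl (step x) a (map left ys)" for x a ys
    by (induction ys arbitrary: a) auto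
  have "PT (\<lambda>x. foldl (\<lambda>acc s. step x acc (left s)) (i x) (suffixes (list_dat (l x))))"
  proof (rule PT_foldl_suffixes[OF i l[unfolded PTL_def] _ B])
    show "PT (\<lambda>z. step (left z) (left (right z)) (left (right (right z))))"
      using PT_comp[OF step, of "\<lambda>z. Node (left z) (Node (left (right z)) (left (right (right z))))"]
      by (simp add: PT_Node PT_left PT_right PT_id)
    fix x ys zs assume "suffixes (list_dat (l x)) = ys @ zs"
    from arg_cong[OF this, of "map left"] have "l x = map left ys @ map left zs"
      by (simp flip: els_suffixes)
    from bd[OF this] show "size (foldl (\<lambda>acc s. step x acc (left s)) (i x) ys) \<le> B (size x)"
      by (simp add: *)
  qed
  then show ?thesis by (simp add: * flip: els_suffixes)
qed

text \<open>The increment allowed per step depends on the parameter and the current element but not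
  on the accumulator. Summed over the list it stays polynomial, whereas a step that doubles its
  accumulator is excluded.\<close>

lemma PT_foldl:
  assumes i: "PT i" and l: "PTL l"
    and step: "PT (\<lambda>z. step (left z) (left (right z)) (right (right z)))"
    and g: "pbounded g"
    and bd: "\<And>x acc a. size (step x acc a) \<le> size acc + g (size x + size a)"
  shows "PT (\<lambda>x. foldl (step x) (i x) (l x))"
proof -
  obtain bi where bi: "pbounded bi" "\<And>x. size (i x) \<le> bi (size x)" using PT_size[OF i] by blast
  obtain bl where bl: "pbounded bl" "\<And>x. size (list_dat (l x)) \<le> bl (size x)"
    using PT_size[OF l[unfolded PTL_def]] by blast
  show ?thesis
  proof (rule PT_foldl_bounded[OF i l step])
    let ?B = "\<lambda>n. bi n + bl n * g (n + bl n)"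
    show "pbounded ?B" by (intro pbounded_intros bi bl pbounded_comp[OF g])
    fix x ys zs assume eq: "l x = ys @ zs"
    have "size (foldl (step x) (i x) ys) \<le> size (i x) + length ys * g (size x + bl (size x))"
    proof (rule size_foldl_additive)
      fix acc a assume "a \<in> set ys"
      then have "size a \<le> size (list_dat (l x))" using size_els[of a "list_dat (l x)"] eq by simp
      also have "\<dots> \<le> bl (size x)" by (rule bl)
      finally have "g (size x + size a) \<le> g (size x + bl (size x))"
        by (intro pbounded_mono[OF g]) simp
      with bd[of x acc a] show "size (step x acc a) \<le> size acc + g (size x + bl (size x))" by simp
    qed
    also have "\<dots> \<le> bi (size x) + bl (size x) * g (size x + bl (size x))"
    proof -
      have "length ys \<le> length (suffixes (list_dat (l x)))"
        using arg_cong[OF els_suffixes[of "list_dat (l x)"], of length] eq by simp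
      then have "length ys \<le> bl (size x)"
        using length_suffixes[of "list_dat (l x)"] bl(2)[of x] by linarith
      then show ?thesis using bi(2)[of x] by (intro add_mono mult_le_mono1)
    qed
    finally show "size (foldl (step x) (i x) ys) \<le> ?B (size x)" .
  qed
qed

lemma PTL_Nil: "PTL (\<lambda>_. [])" unfolding PTL_def by (rule PT_const)

lemma PTL_Cons: "PT f \<Longrightarrow> PTL g \<Longrightarrow> PTL (\<lambda>x. f x # g x)"
  unfolding PTL_def by (simp add: PT_Node)

lemma PTL_els: "PT f \<Longrightarrow> PTL (\<lambda>x. els (f x))" by (simp add: PTL_def)

lemma PT_list_dat: "PTL f \<Longrightarrow> PT (\<lambda>x. list_dat (f x))" by (simp add: PTL_def)

lemma PTL_if: "PTB P \<Longrightarrow> PTL f \<Longrightarrow> PTL g \<Longrightarrow> PTL (\<lambda>x. if P x then f x else g x)"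
  unfolding PTL_def by (simp add: PT_if if_distrib[of list_dat])

lemma PTL_comp2:
  assumes "PTL (\<lambda>z. h (left z) (right z))" "PT f" "PT g" shows "PTL (\<lambda>x. h (f x) (g x))"
  using PT_comp[OF assms(1)[unfolded PTL_def] PT_Node[OF assms(2,3)]] unfolding PTL_def by simp

lemma PTL_foldl:
  assumes i: "PTL i" and l: "PTL l"
    and step: "PTL (\<lambda>z. step (left z) (els (left (right z))) (right (right z)))"
    and g: "pbounded g"
    and bd: "\<And>x acc a. size (list_dat (step x acc a)) \<le> size (list_dat acc) + g (size x + size a)"
  shows "PTL (\<lambda>x. foldl (step x) (i x) (l x))"
proof -
  have *: "list_dat (foldl (step x) acc xs) =
      foldl (\<lambda>acc a. list_dat (step x (els acc) a)) (list_dat acc) xs" for x acc xs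
    by (induction xs arbitrary: acc) auto
  show ?thesis unfolding PTL_def *
    by (rule PT_foldl[OF i[unfolded PTL_def] l step[unfolded PTL_def] g])
      (use bd[of _ "els _"] in simp)
qed

lemma PTL_rev: assumes "PTL f" shows "PTL (\<lambda>x. rev (f x))"
proof -
  have *: "foldl (\<lambda>acc a. a # acc) ys xs = rev xs @ ys" for xs ys :: "dat list"
    by (induction xs arbitrary: ys) auto
  have "PTL (\<lambda>x. foldl (\<lambda>acc a. a # acc) [] (f x))"
    by (rule PTL_foldl[OF PTL_Nil assms _ pbounded_Suc[OF pbounded_id]])
      (auto intro!: PTL_Cons PTL_els PT_left PT_right PT_id)
  then show ?thesis by (simp add: *)
qed

lemma PTL_append: assumes "PTL f" "PTL g" shows "PTL (\<lambda>x. f x @ g x)"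
proof -
  have *: "foldl (\<lambda>acc a. a # acc) ys xs = rev xs @ ys" for xs ys :: "dat list"
    by (induction xs arbitrary: ys) auto
  have "PTL (\<lambda>x. foldl (\<lambda>acc a. a # acc) (g x) (rev (f x)))"
    by (rule PTL_foldl[OF assms(2) PTL_rev[OF assms(1)] _ pbounded_Suc[OF pbounded_id]])
      (auto intro!: PTL_Cons PTL_els PT_left PT_right PT_id)
  then show ?thesis by (simp add: *)
qed

text \<open>Appending \<open>h x a\<close> lengthens the accumulator by an amount independent of it,
  so the additive criterion applies. Mapping and filtering are special cases, and bounded search
  follows by filtering.\<close>

lemma PTL_concat_map:
  assumes h: "PTL (\<lambda>z. h (left z) (right z))" and l: "PTL l"
  shows "PTL (\<lambda>x. concat (map (h x) (l x)))"
proof -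
  have *: "foldl (\<lambda>acc a. acc @ h x a) ys xs = ys @ concat (map (h x) xs)" for x xs ys
    by (induction xs arbitrary: ys) auto
  obtain b where b: "pbounded b" "\<And>z. size (list_dat (h (left z) (right z))) \<le> b (size z)"
    using PT_size[OF h[unfolded PTL_def]] by blast
  have "PTL (\<lambda>x. foldl (\<lambda>acc a. acc @ h x a) [] (l x))"
  proof (rule PTL_foldl[OF PTL_Nil l])
    show "PTL (\<lambda>z. els (left (right z)) @ h (left z) (right (right z)))"
      by (intro PTL_append PTL_els PTL_comp2[OF h] PT_left PT_right PT_id)
    show "pbounded (\<lambda>n. b (n + 1))" by (intro pbounded_comp[OF b(1)] pbounded_intros)
    fix x acc a
    show "size (list_dat (acc @ h x a)) \<le> size (list_dat acc) + b (size x + size a + 1)"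
      using b(2)[of "Node x a"] by (simp add: size_list_dat)
  qed
  then show ?thesis by (simp add: *)
qed

lemma PTL_map:
  assumes h: "PT (\<lambda>z. h (left z) (right z))" and l: "PTL l"
  shows "PTL (\<lambda>x. map (h x) (l x))"
  using PTL_concat_map[OF PTL_Cons[OF h PTL_Nil] l] by (simp add: concat_map_singleton)

lemma PTL_filter:
  assumes P: "PTB (\<lambda>z. P (left z) (right z))" and l: "PTL l"
  shows "PTL (\<lambda>x. filter (P x) (l x))"
proof -
  have *: "concat (map (\<lambda>a. if Q a then [a] else []) xs) = filter Q xs" for Q and xs :: "dat list"
    by (induction xs) auto
  have "PTL (\<lambda>x. concat (map (\<lambda>a. if P x a then [a] else []) (l x)))"
    by (intro PTL_concat_map l PTL_if P PTL_Cons PTL_Nil PT_right PT_id)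
  then show ?thesis by (simp add: *)
qed

lemma PTB_bex:
  assumes P: "PTB (\<lambda>z. P (left z) (right z))" and l: "PTL l"
  shows "PTB (\<lambda>x. \<exists>a\<in>set (l x). P x a)"
proof -
  have "PTB (\<lambda>x. list_dat (filter (P x) (l x)) \<noteq> Leaf)"
    by (intro PTB_neq_Leaf PT_list_dat PTL_filter assms)
  moreover have "list_dat xs \<noteq> Leaf \<longleftrightarrow> xs \<noteq> []" for xs by (cases xs) auto
  ultimately show ?thesis by (simp add: filter_empty_conv)
qed

lemma PTL_suffixes: assumes "PT f" shows "PTL (\<lambda>x. suffixes (f x))"
proof -
  have *: "foldl (\<lambda>acc a. Node a acc) d xs = list_dat (rev xs @ els d)" for xs and d :: dat
    by (induction xs arbitrary: d) auto
  obtain b where b: "pbounded b" "\<And>x. size (f x) \<le> b (size x)" using PT_size[OF assms] by blast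
  have "PT (\<lambda>x. foldl (\<lambda>acc a. Node a acc) Leaf (suffixes (f x)))"
  proof (rule PT_foldl_suffixes[OF PT_Leaf assms])
    show "PT (\<lambda>z. Node (right (right z)) (left (right z)))"
      by (intro PT_Node PT_right PT_left PT_id)
    show "pbounded (\<lambda>n. b n * (b n + 1))" by (intro pbounded_intros b)
    fix x ys zs assume eq: "suffixes (f x) = ys @ zs"
    have len: "length ys \<le> b (size x)"
      using length_suffixes[of "f x"] b(2)[of x] eq by simp
    have "size (foldl (\<lambda>acc a. Node a acc) Leaf ys) \<le> size Leaf + length ys * (b (size x) + 1)"
    proof (rule size_foldl_additive)
      fix acc a assume "a \<in> set ys"
      then have "size a \<le> b (size x)"
        using size_suffix[of a "f x"] b(2)[of x] eq by simp
      then show "size (Node a acc) \<le> size acc + (b (size x) + 1)" by simp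
    qed
    also have "\<dots> \<le> b (size x) * (b (size x) + 1)" by (simp add: mult_le_mono1[OF len] add_mono len)
    finally show "size (foldl (\<lambda>acc a. Node a acc) Leaf ys) \<le> b (size x) * (b (size x) + 1)" .
  qed
  then have "PTL (\<lambda>x. rev (rev (suffixes (f x))))"
    by (intro PTL_rev[of "\<lambda>x. rev (suffixes (f x))"]) (simp add: PTL_def *)
  then show ?thesis by simp
qed

text \<open>The number of elements to drop is given in unary as a list, one application of
  \<open>right\<close> for each of its entries; \<open>right Leaf = Leaf\<close> agrees with
  dropping beyond the end.\<close>

lemma PTL_drop:
  assumes "PTL f" "PTL g" shows "PTL (\<lambda>x. drop (length (g x)) (f x))"
proof -
  have *: "foldl (\<lambda>acc a. right acc) d xs = list_dat (drop (length xs) (els d))" for d and xs :: "dat list"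
  proof (induction xs arbitrary: d)
    case (Cons a xs) then show ?case by (cases d) auto
  qed simp
  have "PT (\<lambda>x. foldl (\<lambda>acc a. right acc) (list_dat (f x)) (g x))"
    by (rule PT_foldl[OF PT_list_dat[OF assms(1)] assms(2) _ pbounded_const[of 0]])
      (auto intro!: PT_left PT_right PT_id size_right)
  then show ?thesis by (simp add: * PTL_def)
qed

section \<open>Binary arithmetic\<close>

text \<open>Total on trees: leading zeros are tolerated and any tree other than \<open>Leaf\<close>
  counts as the bit one, so no validity check is needed before decoding.\<close>

fun dn :: "dat \<Rightarrow> nat" where
  "dn Leaf = 0"
| "dn (Node a b) = of_bool (a \<noteq> Leaf) + 2 * dn b"

lemma nat_dat_0 [simp]: "nat_dat 0 = Leaf" by (simp add: nat_dat.simps)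

lemma nat_dat_pos: "n > 0 \<Longrightarrow> nat_dat n = Node (bool_dat (odd n)) (nat_dat (n div 2))"
  by (subst nat_dat.simps) (simp add: bool_dat_def)

lemma nat_dat_eq_Leaf [simp]: "nat_dat n = Leaf \<longleftrightarrow> n = 0"
  by (cases "n = 0") (simp_all add: nat_dat_pos)

lemma left_nat_dat [simp]: "left (nat_dat n) = bool_dat (odd n)"
  by (cases "n = 0") (simp_all add: nat_dat_pos bool_dat_def)

lemma right_nat_dat [simp]: "right (nat_dat n) = nat_dat (n div 2)"
  by (cases "n = 0") (simp_all add: nat_dat_pos)

lemma dn_nat_dat [simp]: "dn (nat_dat n) = n"
proof (induction n rule: less_induct)
  case (less n)
  show ?case
  proof (cases "n = 0")
    case False
    then have "dn (nat_dat n) = of_bool (odd n) + 2 * (n div 2)"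
      using less by (simp add: nat_dat_pos)
    then show ?thesis by (simp add: odd_two_times_div_two_succ)
  qed simp
qed

lemma nat_dat_bit: "nat_dat (of_bool b + 2 * n) =
    (if \<not> b \<and> n = 0 then Leaf else Node (bool_dat b) (nat_dat n))"
  by (cases "\<not> b \<and> n = 0") (auto simp: nat_dat_pos)

definition nlen :: "nat \<Rightarrow> nat" where "nlen n = length (els (nat_dat n))"

lemma nlen_0 [simp]: "nlen 0 = 0" by (simp add: nlen_def)

lemma nlen_pos: "n > 0 \<Longrightarrow> nlen n = Suc (nlen (n div 2))"
  by (simp add: nlen_def nat_dat_pos)

lemma nlen_less: "n < 2 ^ nlen n"
proof (induction n rule: less_induct)
  case (less n)
  show ?case
  proof (cases "n = 0")
    case False
    then have "n div 2 < 2 ^ nlen (n div 2)" using less by simp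
    then show ?thesis using False by (simp add: nlen_pos)
  qed simp
qed

text \<open>Together with \<open>nlen_less\<close> this makes \<open>2 ^ nlen n\<close> a power of
  two above \<open>n\<close> and within a factor of two of it, the rounding behind the integer
  weights.\<close>

lemma nlen_ge: "n > 0 \<Longrightarrow> 2 ^ nlen n \<le> 2 * n"
proof (induction n rule: less_induct)
  case (less n)
  show ?case
  proof (cases "n = 1")
    case False
    then have "2 ^ nlen (n div 2) \<le> 2 * (n div 2)" using less by simp
    then show ?thesis using less.prems by (simp add: nlen_pos)
  qed (simp add: nlen_pos)
qed

text \<open>If neither summand vanishes, both lengths are at least one, which leaves room for the
  carry. A bound additive in the lengths passes directly to sums over lists.\<close>

lemma nlen_add: "nlen (a + b) \<le> nlen a + nlen b"
proof (cases "a = 0 \<or> b = 0")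
  case False
  then have pos: "nlen a > 0" "nlen b > 0" by (simp_all add: nlen_pos)
  obtain u v where uv: "nlen a = Suc u" "nlen b = Suc v" using pos gr0_implies_Suc by metis
  have "2 ^ nlen (a + b) \<le> 2 * (a + b)" using False by (intro nlen_ge) simp
  also have "\<dots> < 2 * (2 ^ nlen a + 2 ^ nlen b)" using nlen_less[of a] nlen_less[of b] by simp
  also have "\<dots> \<le> 2 * (2 ^ (nlen a + nlen b))"
  proof -
    have "(2::nat) ^ u + 2 ^ v \<le> 2 * (2 ^ u * 2 ^ v)"
    proof -
      obtain m n where "(2::nat) ^ u = Suc m" "(2::nat) ^ v = Suc n"
        by (metis not0_implies_Suc power_not_zero zero_neq_numeral)
      then show ?thesis by simp
    qed
    then show ?thesis by (simp add: uv power_add)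
  qed
  finally have "(2::nat) ^ nlen (a + b) < 2 ^ Suc (nlen a + nlen b)" by simp
  then have "nlen (a + b) < Suc (nlen a + nlen b)" by (rule power_less_imp_less_exp[rotated]) simp
  then show ?thesis by simp
qed auto

lemma size_nat_dat: "size (nat_dat n) \<le> 2 * nlen n"
proof (induction n rule: less_induct)
  case (less n)
  show ?case
  proof (cases "n = 0")
    case False
    then show ?thesis using less[of "n div 2"] bool_dat_simps(2)[of "odd n"]
      by (simp add: nat_dat_pos nlen_pos)
  qed simp
qed

lemma nlen_le_size: "nlen n \<le> size (nat_dat n)"
  using length_suffixes[of "nat_dat n"] els_suffixes[of "nat_dat n"] by (simp add: nlen_def)

lemma PT_nat_dat: "PTN f \<Longrightarrow> PT (\<lambda>x. nat_dat (f x))" by (simp add: PTN_def)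

lemma PTN_const: "PTN (\<lambda>_. n)" unfolding PTN_def by (rule PT_const)

text \<open>The numeral is rebuilt from its most significant digit; a zero put in front of
  \<open>Leaf\<close> is discarded, so leading zeros never enter and the result is
  canonical.\<close>

lemma PTN_dn: assumes "PT f" shows "PTN (\<lambda>x. dn (f x))"
proof -
  let ?step = "\<lambda>acc a. if \<not> a \<noteq> Leaf \<and> acc = Leaf then Leaf else Node (bool_dat (a \<noteq> Leaf)) acc"
  have *: "foldl ?step Leaf (rev (els d)) = nat_dat (dn d)" for d
    by (induction d) (auto simp: nat_dat_bit)
  have "PT (\<lambda>x. foldl ?step Leaf (rev (els (f x))))"
  proof (rule PT_foldl[OF PT_Leaf PTL_rev[OF PTL_els[OF assms]] _ pbounded_const[of 2]])
    show "PT (\<lambda>z. if \<not> right (right z) \<noteq> Leaf \<and> left (right z) = Leaf then Leaf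
        else Node (bool_dat (right (right z) \<noteq> Leaf)) (left (right z)))"
      by (intro PT_if PTB_conj PTB_not PTB_eq_Leaf PTB_neq_Leaf PT_bool_dat PT_Node PT_Leaf PT_right PT_left PT_id)
    show "size (?step acc a) \<le> size acc + 2" for x acc a :: dat
      by (auto simp: bool_dat_def)
  qed
  then show ?thesis unfolding PTN_def * .
qed

text \<open>State of a ripple-carry adder: reversed output, carry, and the remaining bits of both summands.\<close>

definition add_step :: "dat \<Rightarrow> dat \<Rightarrow> dat" where
  "add_step acc a = (let out = left acc; c = left (right acc); A = left (right (right acc));
      B = right (right (right acc)); p = left A \<noteq> Leaf; q = left B \<noteq> Leaf; r = c \<noteq> Leaf in
    if A = Leaf \<and> B = Leaf \<and> c = Leaf then acc
    else Node (Node (bool_dat (p = (q = r))) out)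
      (Node (bool_dat (if p then q \<or> r else q \<and> r)) (Node (right A) (right B))))"

lemma size_left_right: "size (left x) + size (right x) \<le> size x"
  by (cases x) auto

text \<open>The outgoing carry is written as the event that halving the sum gives more than the sum
  of the halves. In this form \<open>add_div2_carry\<close> restores the invariant of the adder
  without inspecting bits.\<close>

lemma add_step_nat_dat:
  "add_step (Node out (Node (bool_dat c) (Node (nat_dat a) (nat_dat b)))) d =
    (if a + b + of_bool c = 0 then Node out (Node (bool_dat c) (Node (nat_dat a) (nat_dat b)))
     else Node (Node (bool_dat (odd (a + b + of_bool c))) out)
       (Node (bool_dat ((a + b + of_bool c) div 2 > a div 2 + b div 2))
         (Node (nat_dat (a div 2)) (nat_dat (b div 2)))))"
proof -
  have "(a + b + of_bool c) div 2 > a div 2 + b div 2 \<longleftrightarrow>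
      (if odd a then odd b \<or> c else odd b \<and> c)"
    by (cases c; cases "odd a"; cases "odd b"; simp; presburger)
  moreover have "odd (a + b + of_bool c) \<longleftrightarrow> (odd a = (odd b = c))" by auto
  ultimately show ?thesis by (simp add: add_step_def)
qed

lemma add_div2_carry: "a div 2 + b div 2 + of_bool ((a + b + of_bool c) div 2 > a div 2 + b div 2) =
    (a + b + of_bool c) div (2::nat)"
  by (cases c; cases "odd a"; cases "odd b") (auto elim!: evenE oddE)

text \<open>The list \<open>ys\<close> serves only as a clock. Each effective step strictly lowers
  the sum of both lengths and the carry, and once everything is consumed the state no longer
  changes, so surplus ticks are harmless.\<close>

lemma add_steps:
  assumes "nlen a + nlen b + of_bool c \<le> length ys"
  shows "left (foldl add_step (Node out (Node (bool_dat c) (Node (nat_dat a) (nat_dat b)))) ys) =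
    list_dat (rev (els (nat_dat (a + b + of_bool c))) @ els out)"
  using assms
proof (induction ys arbitrary: a b c out)
  case Nil
  then have "nlen a = 0" "nlen b = 0" "\<not> c" by auto
  then have "a = 0" "b = 0" using nlen_pos by (metis gr0I nat.distinct(1))+
  then show ?case using \<open>\<not> c\<close> by simp
next
  case (Cons d ys)
  show ?case
  proof (cases "a + b + of_bool c = 0")
    case True
    moreover have "left (foldl add_step (Node out (Node (bool_dat False)
        (Node (nat_dat 0) (nat_dat 0)))) ys) = list_dat (rev (els (nat_dat (0 + 0 + of_bool False))) @ els out)"
      by (rule Cons.IH) simp
    ultimately show ?thesis using add_step_nat_dat[of out False 0 0 d] by simp
  next
    case False
    let ?c = "(a + b + of_bool c) div 2 > a div 2 + b div 2"
    have "left (foldl add_step (Node (Node (bool_dat (odd (a + b + of_bool c))) out)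
       (Node (bool_dat ?c) (Node (nat_dat (a div 2)) (nat_dat (b div 2))))) ys) =
      list_dat (rev (els (nat_dat (a div 2 + b div 2 + of_bool ?c))) @
        els (Node (bool_dat (odd (a + b + of_bool c))) out))"
    proof (rule Cons.IH)
      have "nlen (a div 2) + nlen (b div 2) + of_bool ?c < nlen a + nlen b + of_bool c"
        using False by (cases "a = 0"; cases "b = 0"; cases c) (auto simp: nlen_pos)
      then show "nlen (a div 2) + nlen (b div 2) + of_bool ?c \<le> length ys"
        using Cons.prems by simp
    qed
    moreover have "nat_dat (a + b + of_bool c) =
        Node (bool_dat (odd (a + b + of_bool c))) (nat_dat ((a + b + of_bool c) div 2))"
      using False by (intro nat_dat_pos) simp
    ultimately show ?thesis
      by (simp only: foldl.simps add_step_nat_dat False if_False add_div2_carry els.simps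
          rev.simps append_assoc append.simps)
  qed
qed

lemma PTN_add:
  assumes "PTN f" "PTN g" shows "PTN (\<lambda>x. f x + g x)"
proof -
  let ?i = "\<lambda>x. Node Leaf (Node (bool_dat False) (Node (nat_dat (f x)) (nat_dat (g x))))"
  let ?l = "\<lambda>x. els (nat_dat (f x)) @ els (nat_dat (g x))"
  note intros = PT_nat_dat PT_Node PT_Leaf PT_bool_dat PTB_const PT_left PT_right PT_id PTB_eq_Leaf PTB_neq_Leaf
    PTB_conj PTB_disj PTB_iff PT_if PTB_if PTL_append PTL_els
  have "PT (\<lambda>x. foldl add_step (?i x) (?l x))"
  proof (rule PT_foldl[OF _ _ _ pbounded_const[of 6]])
    show "PT ?i" "PTL ?l" by (intro intros assms)+
    show "PT (\<lambda>z. add_step (left (right z)) (right (right z)))"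
      unfolding add_step_def Let_def by (intro intros)
    fix x acc a
    show "size (add_step acc a) \<le> size acc + 6"
      using size_left_right[of acc] size_left_right[of "right acc"]
        size_left_right[of "right (right acc)"] size_right[of "left (right (right acc))"]
        size_right[of "right (right (right acc))"]
      by (auto simp: add_step_def Let_def bool_dat_def)
  qed
  then have "PTL (\<lambda>x. rev (els (left (foldl add_step (?i x) (?l x)))))"
    by (intro PTL_rev PTL_els PT_left)
  moreover have "left (foldl add_step (?i x) (?l x)) = list_dat (rev (els (nat_dat (f x + g x))))" for x
    using add_steps[of "f x" "g x" False "?l x" Leaf] by (simp add: nlen_def)
  ultimately show ?thesis unfolding PTL_def PTN_def by simp
qed

text \<open>
  The flag in \<open>left acc\<close> records the comparison of the bits already consumed; more significant bits
  override it.
\<close>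

definition le_step :: "dat \<Rightarrow> dat \<Rightarrow> dat" where
  "le_step acc a = (let A = left (right acc); B = right (right acc) in
     Node (if (left A \<noteq> Leaf) = (left B \<noteq> Leaf) then left acc else bool_dat (left A = Leaf))
       (Node (right A) (right B)))"

text \<open>Again \<open>ys\<close> is a clock: exhausted numerals supply equal zero bits, which
  keep the flag. The initial flag \<open>c\<close> decides ties, so starting with
  \<open>True\<close> yields \<le>.\<close>

lemma le_steps:
  assumes "nlen a \<le> length ys" "nlen b \<le> length ys"
  shows "left (foldl le_step (Node (bool_dat c) (Node (nat_dat a) (nat_dat b))) ys) =
    bool_dat (a < b \<or> a = b \<and> c)"
  using assms
proof (induction ys arbitrary: a b c)
  case Nil
  then have "a = 0" "b = 0" using nlen_pos by (metis gr0I nat.distinct(1) le_zero_eq list.size(3))+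
  then show ?case by simp
next
  case (Cons d ys)
  let ?c = "if odd a = odd b then c else even a"
  have "le_step (Node (bool_dat c) (Node (nat_dat a) (nat_dat b))) d =
      Node (bool_dat ?c) (Node (nat_dat (a div 2)) (nat_dat (b div 2)))"
    by (simp add: le_step_def)
  moreover have "left (foldl le_step (Node (bool_dat ?c) (Node (nat_dat (a div 2)) (nat_dat (b div 2)))) ys) =
      bool_dat (a div 2 < b div 2 \<or> a div 2 = b div 2 \<and> ?c)"
  proof (rule Cons.IH)
    show "nlen (a div 2) \<le> length ys" "nlen (b div 2) \<le> length ys"
      using Cons.prems by (cases "a = 0"; cases "b = 0"; simp add: nlen_pos)+
  qed
  moreover have "a div 2 < b div 2 \<or> a div 2 = b div 2 \<and> ?c \<longleftrightarrow> a < b \<or> a = b \<and> c"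
    by (cases "odd a"; cases "odd b") (auto elim!: evenE oddE, presburger)
  ultimately show ?case by simp
qed

lemma PTB_le:
  assumes "PTN f" "PTN g" shows "PTB (\<lambda>x. f x \<le> g x)"
proof -
  let ?i = "\<lambda>x. Node (bool_dat True) (Node (nat_dat (f x)) (nat_dat (g x)))"
  let ?l = "\<lambda>x. els (nat_dat (f x)) @ els (nat_dat (g x))"
  note intros = PT_nat_dat PT_Node PT_Leaf PT_bool_dat PTB_const PT_left PT_right PT_id PTB_eq_Leaf PTB_neq_Leaf
    PTB_conj PTB_disj PTB_iff PT_if PTB_if PTL_append PTL_els
  have "PT (\<lambda>x. foldl le_step (?i x) (?l x))"
  proof (rule PT_foldl[OF _ _ _ pbounded_const[of 6]])
    show "PT ?i" "PTL ?l" by (intro intros assms)+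
    show "PT (\<lambda>z. le_step (left (right z)) (right (right z)))"
      unfolding le_step_def Let_def by (intro intros)
    fix x acc a
    show "size (le_step acc a) \<le> size acc + 6"
      using size_left_right[of acc] size_left_right[of "right acc"]
        size_right[of "left (right acc)"] size_right[of "right (right acc)"]
      by (auto simp: le_step_def Let_def bool_dat_def)
  qed
  then have "PT (\<lambda>x. left (foldl le_step (?i x) (?l x)))" by (rule PT_left)
  moreover have "left (foldl le_step (?i x) (?l x)) = bool_dat (f x \<le> g x)" for x
    using le_steps[of "f x" "?l x" "g x" True] by (simp add: nlen_def le_less)
  ultimately show ?thesis unfolding PTB_def by simp
qed

lemma PTB_less: "PTN f \<Longrightarrow> PTN g \<Longrightarrow> PTB (\<lambda>x. f x < g x)"
  using PTB_not[OF PTB_le] by (simp add: not_le)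

lemma PTB_nat_eq: "PTN f \<Longrightarrow> PTN g \<Longrightarrow> PTB (\<lambda>x. f x = g x)"
  unfolding order_eq_iff by (intro PTB_conj PTB_le)

lemma PTN_comp2:
  assumes "PTN (\<lambda>z. h (left z) (right z))" "PT f" "PT g" shows "PTN (\<lambda>x. h (f x) (g x))"
  using PT_comp[OF assms(1)[unfolded PTN_def] PT_Node[OF assms(2,3)]] unfolding PTN_def by simp

lemma nlen_sum_list: "nlen (\<Sum>a\<leftarrow>xs. f a) \<le> (\<Sum>a\<leftarrow>xs. nlen (f a))"
proof (induction xs)
  case (Cons a xs) then show ?case using nlen_add[of "f a" "\<Sum>a\<leftarrow>xs. f a"] by simp
qed simp

text \<open>Partial sums are bounded as a whole, through subadditivity of \<open>nlen\<close>, by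
  the total size of all summands. The factor two lost in \<open>size_nat_dat\<close> is then paid
  once; applied step by step it would compound.\<close>

lemma PTN_sum_list:
  assumes h: "PTN (\<lambda>z. h (left z) (right z))" and l: "PTL l"
  shows "PTN (\<lambda>x. \<Sum>a\<leftarrow>l x. h x a)"
proof -
  have *: "foldl (\<lambda>acc a. nat_dat (dn acc + h x a)) (nat_dat n) ys = nat_dat (n + (\<Sum>a\<leftarrow>ys. h x a))"
    for x n ys by (induction ys arbitrary: n) (auto simp: add.assoc)
  have sz: "size (nat_dat (\<Sum>a\<leftarrow>ys. h x a)) \<le> 2 * size (list_dat (map (\<lambda>a. nat_dat (h x a)) (ys @ zs)))"
    for x ys zs
  proof -
    have "size (nat_dat (\<Sum>a\<leftarrow>ys. h x a)) \<le> 2 * nlen (\<Sum>a\<leftarrow>ys. h x a)" by (rule size_nat_dat)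
    also have "\<dots> \<le> 2 * (\<Sum>a\<leftarrow>ys. nlen (h x a))" using nlen_sum_list by simp
    also have "\<dots> \<le> 2 * (\<Sum>a\<leftarrow>ys. size (nat_dat (h x a)) + 1)"
      using nlen_le_size by (intro mult_left_mono sum_list_mono) (auto intro: le_SucI)
    also have "\<dots> \<le> 2 * size (list_dat (map (\<lambda>a. nat_dat (h x a)) (ys @ zs)))"
      by (simp add: size_list_dat o_def)
    finally show ?thesis .
  qed
  have "PTL (\<lambda>x. map (\<lambda>a. nat_dat (h x a)) (l x))"
    using h l by (intro PTL_map PT_nat_dat)
  then obtain b where b: "pbounded b" "\<And>x. size (list_dat (map (\<lambda>a. nat_dat (h x a)) (l x))) \<le> b (size x)"
    using PT_size unfolding PTL_def by blast
  have "PT (\<lambda>x. foldl (\<lambda>acc a. nat_dat (dn acc + h x a)) (nat_dat 0) (l x))"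
  proof (rule PT_foldl_bounded[OF PT_const l])
    show "PT (\<lambda>z. nat_dat (dn (left (right z)) + h (left z) (right (right z))))"
      by (intro PT_nat_dat PTN_add PTN_dn PTN_comp2[OF h] PT_left PT_right PT_id)
    show "pbounded (\<lambda>n. 2 * b n)" by (intro pbounded_intros b)
    show "size (foldl (\<lambda>acc a. nat_dat (dn acc + h x a)) (nat_dat 0) ys) \<le> 2 * b (size x)"
      if "l x = ys @ zs" for x ys zs
      using sz[where x = x and ys = ys and zs = zs] b(2)[of x] that by (simp only: * add_0)
  qed
  then show ?thesis unfolding PTN_def * by simp
qed

lemma PTN_length: "PTL l \<Longrightarrow> PTN (\<lambda>x. length (l x))"
  using PTN_sum_list[OF PTN_const[of 1]] by (simp add: sum_list_triv)

text \<open>The exponent is given in unary, which keeps the result of polynomial size; each entry of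
  the list prepends a zero bit and thereby doubles the number.\<close>

lemma PTN_power2_length:
  assumes "PTL l" shows "PTN (\<lambda>x. 2 ^ length (l x))"
proof -
  have *: "foldl (\<lambda>acc a. Node Leaf acc) (nat_dat n) ys = nat_dat (2 ^ length ys * n)"
    if "n > 0" for n and ys :: "dat list" using that
  proof (induction ys arbitrary: n)
    case (Cons y ys)
    have "Node Leaf (nat_dat n) = nat_dat (2 * n)"
      using nat_dat_bit[of False n] Cons.prems by (simp add: bool_dat_def)
    then show ?case using Cons by (simp add: mult.left_commute mult.assoc)
  qed simp
  have "PT (\<lambda>x. foldl (\<lambda>acc a. Node Leaf acc) (nat_dat 1) (l x))"
    by (rule PT_foldl[OF PT_const assms _ pbounded_const[of 1]])
      (auto intro!: PT_Node PT_Leaf PT_left PT_right PT_id)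
  then show ?thesis by (simp add: * PTN_def)
qed

section \<open>Greedy selection of vehicles\<close>

definition conflict_sum :: "('e \<Rightarrow> nat) \<Rightarrow> ('e \<Rightarrow> 'e \<Rightarrow> bool) \<Rightarrow> 'e list \<Rightarrow> 'e \<Rightarrow> nat" where
  "conflict_sum w conf M F = (\<Sum>G\<leftarrow>filter (conf F) M. w G)"

definition insert_edge :: "('e \<Rightarrow> nat) \<Rightarrow> ('e \<Rightarrow> 'e \<Rightarrow> bool) \<Rightarrow> 'e list \<Rightarrow> 'e \<Rightarrow> 'e list" where
  "insert_edge w conf M F =
     (if 2 * conflict_sum w conf M F \<le> w F then F # filter (\<lambda>G. \<not> conf F G) M else M)"

definition add_vehicle ::
    "('e \<Rightarrow> nat) \<Rightarrow> ('e \<Rightarrow> 'e \<Rightarrow> bool) \<Rightarrow> ('e \<Rightarrow> nat) \<Rightarrow> 'e list \<Rightarrow> 'e list \<Rightarrow> nat \<Rightarrow> 'e list" where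
  "add_vehicle w conf ve E M i = foldl (insert_edge w conf) M (filter (\<lambda>F. ve F = i) E)"

lemma sum_list_filter_split:
  "(\<Sum>G\<leftarrow>M. w G) = (\<Sum>G\<leftarrow>filter P M. w G) + (\<Sum>G\<leftarrow>filter (\<lambda>G. \<not> P G) M. w G :: nat)"
  by (induction M) auto

lemma sum_list_filter_le: "(\<Sum>G\<leftarrow>filter P M. w G :: nat) \<le> (\<Sum>G\<leftarrow>M. w G)"
  using sum_list_filter_split[of w M P] by simp

text \<open>\<open>J\<close> lists all edges ever inserted, including those that are evicted later.\<close>

lemma insert_edges_inserted:
  assumes refl: "\<And>F. conf F F"
  obtains J where "set J \<subseteq> set L"
    "2 * (\<Sum>G\<leftarrow>M. w G) + (\<Sum>G\<leftarrow>J. w G) \<le> 2 * (\<Sum>G\<leftarrow>foldl (insert_edge w conf) M L. w G)"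
    "\<And>F. F \<in> set L \<Longrightarrow> w F \<le> 2 * conflict_sum w conf M F + 2 * conflict_sum w conf J F"
proof -
  \<comment> \<open>The clause for all \<open>P\<close> is auxiliary to the induction: a rejected
    edge is compared with the edges held at that moment, and taking \<open>conf F\<close> for
    \<open>P\<close> transfers their weight to \<open>M\<close> and \<open>J\<close>.\<close>
  have "\<exists>J. set J \<subseteq> set L \<and>
    (\<forall>P. (\<Sum>G\<leftarrow>filter P (foldl (insert_edge w conf) M L). w G) \<le>
       (\<Sum>G\<leftarrow>filter P M. w G) + (\<Sum>G\<leftarrow>filter P J. w G)) \<and>
    2 * (\<Sum>G\<leftarrow>M. w G) + (\<Sum>G\<leftarrow>J. w G) \<le> 2 * (\<Sum>G\<leftarrow>foldl (insert_edge w conf) M L. w G) \<and>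
    (\<forall>F\<in>set L. w F \<le> 2 * conflict_sum w conf M F + 2 * conflict_sum w conf J F)"
  proof (induction L rule: rev_induct)
    case Nil
    show ?case by (rule exI[of _ "[]"]) simp
  next
    case (snoc F L)
    then obtain J where J: "set J \<subseteq> set L"
      "\<And>P. (\<Sum>G\<leftarrow>filter P (foldl (insert_edge w conf) M L). w G) \<le>
         (\<Sum>G\<leftarrow>filter P M. w G) + (\<Sum>G\<leftarrow>filter P J. w G)"
      "2 * (\<Sum>G\<leftarrow>M. w G) + (\<Sum>G\<leftarrow>J. w G) \<le> 2 * (\<Sum>G\<leftarrow>foldl (insert_edge w conf) M L. w G)"
      "\<And>F. F \<in> set L \<Longrightarrow> w F \<le> 2 * conflict_sum w conf M F + 2 * conflict_sum w conf J F"
      by blast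
    let ?M = "foldl (insert_edge w conf) M L"
    show ?case
    proof (cases "2 * conflict_sum w conf ?M F \<le> w F")
      case True
      then have eq: "foldl (insert_edge w conf) M (L @ [F]) = F # filter (\<lambda>G. \<not> conf F G) ?M"
        by (simp add: insert_edge_def)
      \<comment> \<open>The evicted weight is at most half of \<open>w F\<close>, so twice the held
        total grows by at least \<open>w F\<close>, the amount by which the total of
        \<open>J\<close> grows.\<close>
      have "2 * (\<Sum>G\<leftarrow>M. w G) + (\<Sum>G\<leftarrow>F # J. w G) \<le>
          2 * (\<Sum>G\<leftarrow>F # filter (\<lambda>G. \<not> conf F G) ?M. w G)"
        using J(3) True sum_list_filter_split[of w ?M "conf F"] by (simp add: conflict_sum_def)
      moreover have "(\<Sum>G\<leftarrow>filter P (F # filter (\<lambda>G. \<not> conf F G) ?M). w G) \<le>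
         (\<Sum>G\<leftarrow>filter P M. w G) + (\<Sum>G\<leftarrow>filter P (F # J). w G)" for P
      proof -
        have "(\<Sum>G\<leftarrow>filter P (filter (\<lambda>G. \<not> conf F G) ?M). w G) \<le> (\<Sum>G\<leftarrow>filter P ?M. w G)"
          using sum_list_filter_le[of w "\<lambda>G. \<not> conf F G" "filter P ?M"]
          by (simp add: filter_filter conj_commute)
        then show ?thesis using J(2)[of P] by (cases "P F") simp_all
      qed
      \<comment> \<open>An accepted edge conflicts with itself and now belongs to the inserted list,
        so it pays for itself.\<close>
      moreover have "w F' \<le> 2 * conflict_sum w conf M F' + 2 * conflict_sum w conf (F # J) F'"
        if "F' \<in> set (L @ [F])" for F'
        using that J(4)[of F'] refl by (auto simp: conflict_sum_def)
      ultimately show ?thesis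
        unfolding eq using J(1) by (intro exI[of _ "F # J"]) auto
    next
      case False
      then have eq: "foldl (insert_edge w conf) M (L @ [F]) = ?M"
        by (simp add: insert_edge_def)
      have "w F \<le> 2 * conflict_sum w conf M F + 2 * conflict_sum w conf J F"
        using False J(2)[of "conf F"] by (simp add: conflict_sum_def)
      then show ?thesis
        unfolding eq using J by (intro exI[of _ J]) auto
    qed
  qed
  then show ?thesis using that by blast
qed

text \<open>Double counting of conflicting pairs: each entry \<open>G\<close> of \<open>J\<close>
  contributes \<open>w G\<close> once for every member of \<open>X\<close> in conflict with
  it.\<close>

lemma sum_conflict_sum_le:
  assumes "finite X" "\<And>G. G \<in> set J \<Longrightarrow> card {F\<in>X. conf F G} \<le> d"
  shows "(\<Sum>F\<in>X. conflict_sum w conf J F) \<le> d * (\<Sum>G\<leftarrow>J. w G)"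
  using assms(2)
proof (induction J)
  case Nil then show ?case by (simp add: conflict_sum_def)
next
  case (Cons G J)
  have "(\<Sum>F\<in>X. conflict_sum w conf (G # J) F) =
      (\<Sum>F\<in>X. (if conf F G then w G else 0) + conflict_sum w conf J F)"
    by (intro sum.cong) (auto simp: conflict_sum_def)
  also have "\<dots> = card {F\<in>X. conf F G} * w G + (\<Sum>F\<in>X. conflict_sum w conf J F)"
    using assms(1) by (simp add: sum.distrib sum.If_cases Int_def)
  also have "\<dots> \<le> d * w G + d * (\<Sum>G\<leftarrow>J. w G)"
    using Cons by (intro add_mono mult_le_mono1) auto
  finally show ?case by (simp add: algebra_simps)
qed

text \<open>Adding vehicles one after the other is a single run of edge insertions, so
  \<open>insert_edges_inserted\<close> can be applied to a whole sequence of vehicles at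
  once.\<close>

lemma foldl_add_vehicle:
  "foldl (add_vehicle w conf ve E) M vs =
    foldl (insert_edge w conf) M (concat (map (\<lambda>i. filter (\<lambda>F. ve F = i) E) vs))"
  by (induction vs arbitrary: M) (auto simp: add_vehicle_def)

lemma set_insert_edges: "set (foldl (insert_edge w conf) M L) \<subseteq> set M \<union> set L"
proof (induction L arbitrary: M)
  case (Cons F L)
  have "set (insert_edge w conf M F) \<subseteq> insert F (set M)" by (auto simp: insert_edge_def)
  then show ?case using Cons[of "insert_edge w conf M F"] by auto
qed simp

lemma insert_edges_independent:
  assumes "\<And>F. conf F F" "\<And>F G. conf F G \<Longrightarrow> conf G F"
    "distinct M" "pairwise (\<lambda>F G. \<not> conf F G) (set M)"
  shows "distinct (foldl (insert_edge w conf) M L) \<and>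
    pairwise (\<lambda>F G. \<not> conf F G) (set (foldl (insert_edge w conf) M L))"
  using assms(3,4)
proof (induction L arbitrary: M)
  case (Cons F L)
  have "distinct (insert_edge w conf M F)"
    "pairwise (\<lambda>F G. \<not> conf F G) (set (insert_edge w conf M F))"
    using Cons.prems assms(1,2) by (auto simp: insert_edge_def pairwise_def)
  then show ?case using Cons.IH by simp
qed simp

text \<open>Edges are abstract here, so scenarios, values and encodings disappear. \<open>X\<close>
  stands for the optimum pooled over all scenarios, \<open>B\<close> for the basis vehicles and
  \<open>A\<close> for the augmented ones. A vehicle may own many edges of \<open>X\<close>, one per
  scenario; \<open>deg1\<close> reflects that an edge conflicts only within its own scenario. The
  factor 8 is the sum of a factor 4 for the served and 4 for the missed part of
  \<open>X\<close>.\<close>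

theorem greedy_vehicles_bound:
  fixes w :: "'e \<Rightarrow> nat" and conf :: "'e \<Rightarrow> 'e \<Rightarrow> bool" and ve :: "'e \<Rightarrow> nat"
    and E :: "'e list" and p K :: nat
  defines "build \<equiv> foldl (add_vehicle w conf ve E) []"
  defines "W \<equiv> \<lambda>M. \<Sum>G\<leftarrow>M. w G"
  assumes refl: "\<And>F. conf F F"
    and X: "finite X" "X \<subseteq> set E"
    and deg: "\<And>G. G \<in> set E \<Longrightarrow> card {F\<in>X. conf F G} \<le> p"
    and deg1: "\<And>G i. G \<in> set E \<Longrightarrow> card {F\<in>X. ve F = i \<and> conf F G} \<le> 1"
    and veX: "ve ` X \<subseteq> set B \<union> A" "card (ve ` X \<inter> A) \<le> K"
    and A: "finite A" and S: "distinct S" "set S \<subseteq> A" "length S = min K (card A)"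
    and greedy: "\<And>j i. j < length S \<Longrightarrow> i \<in> A - set (take j S) \<Longrightarrow>
      W (build (B @ take j S @ [i])) \<le> W (build (B @ take (Suc j) S))"
    and p: "2 \<le> p"
  shows "(\<Sum>F\<in>X. w F) \<le> 8 * p * W (build (B @ S))"
proof -
  let ?n = "length S"
  define V where "V j = W (build (B @ take j S))" for j
  have V_n: "V ?n = W (build (B @ S))" by (simp add: V_def)
  have subE: "set (build vs) \<subseteq> set E" for vs
    using set_insert_edges[of w conf "[]"] by (fastforce simp: build_def foldl_add_vehicle)
  have step: "W M \<le> W (add_vehicle w conf ve E M i)" for M i
  proof -
    obtain J where "2 * W M + W J \<le> 2 * W (add_vehicle w conf ve E M i)"
      unfolding W_def add_vehicle_def
      by (rule insert_edges_inserted[where conf = conf and w = w and M = M and L = "filter (\<lambda>F. ve F = i) E",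
            OF refl]) blast
    then show ?thesis by simp
  qed
  have V_mono: "V j \<le> V ?n" if "j \<le> ?n" for j
  proof -
    have "V j \<le> W (foldl (add_vehicle w conf ve E) (build (B @ take j S)) ys)" for ys
      by (induction ys rule: rev_induct) (auto simp: V_def intro: order_trans[OF _ step])
    from this[of "drop j S"] show ?thesis unfolding V_n
      by (simp add: build_def flip: foldl_append)
  qed
  define R where "R = (ve ` X \<inter> A) - set S"
  define X1 where "X1 = {F\<in>X. ve F \<in> set B \<union> set S}"
  define X2 where "X2 = {F\<in>X. ve F \<in> R}"
  have finX: "finite X1" "finite X2" "finite R" using X A by (auto simp: X1_def X2_def R_def)
  have "X \<subseteq> X1 \<union> X2" using veX by (auto simp: X1_def X2_def R_def)
  then have "(\<Sum>F\<in>X. w F) \<le> (\<Sum>F\<in>X1 \<union> X2. w F)" using finX by (intro sum_mono2) auto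
  also have "\<dots> \<le> (\<Sum>F\<in>X1. w F) + (\<Sum>F\<in>X2. w F)"
    using sum.union_inter[OF finX(1,2), of w] by linarith
  also have "(\<Sum>F\<in>X1. w F) \<le> 4 * p * V ?n"
  proof -
    let ?L = "concat (map (\<lambda>i. filter (\<lambda>F. ve F = i) E) (B @ S))"
    obtain J where J: "set J \<subseteq> set ?L" "2 * W [] + W J \<le> 2 * W (build (B @ S))"
      "\<And>F. F \<in> set ?L \<Longrightarrow> w F \<le> 2 * conflict_sum w conf [] F + 2 * conflict_sum w conf J F"
      unfolding W_def build_def foldl_add_vehicle
      by (rule insert_edges_inserted[where conf = conf and w = w and M = "[]" and L = ?L,
            OF refl]) blast
    have "(\<Sum>F\<in>X1. w F) \<le> (\<Sum>F\<in>X1. 2 * conflict_sum w conf J F)"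
    proof (rule sum_mono)
      fix F assume "F \<in> X1"
      then have "F \<in> set ?L" using X by (auto simp: X1_def)
      from J(3)[OF this] show "w F \<le> 2 * conflict_sum w conf J F" by (simp add: conflict_sum_def)
    qed
    also have "\<dots> = 2 * (\<Sum>F\<in>X1. conflict_sum w conf J F)" by (simp add: sum_distrib_left)
    also have "(\<Sum>F\<in>X1. conflict_sum w conf J F) \<le> p * W J"
      unfolding W_def
    proof (rule sum_conflict_sum_le[OF finX(1)])
      fix G assume "G \<in> set J"
      then have "G \<in> set E" using J(1) by auto
      have "card {F\<in>X1. conf F G} \<le> card {F\<in>X. conf F G}"
        using X by (intro card_mono) (auto simp: X1_def)
      then show "card {F\<in>X1. conf F G} \<le> p" using deg[OF \<open>G \<in> set E\<close>] by simp
    qed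
    also have "p * W J \<le> p * (2 * V ?n)"
      using J(2) unfolding V_n by (intro mult_le_mono2) (simp add: W_def)
    finally show ?thesis by (simp add: mult_ac)
  qed
  also have "(\<Sum>F\<in>X2. w F) \<le> 4 * p * V ?n"
  proof (cases "R = {}")
    case True then show ?thesis by (simp add: X2_def)
  next
    case False
    \<comment> \<open>A selection shorter than the budget has exhausted all of \<open>A\<close>, and
      then no vehicle is missed.\<close>
    have nK: "?n = K"
    proof (rule ccontr)
      assume "?n \<noteq> K"
      then have "card (set S) = card A" using S by (simp add: distinct_card)
      then have "set S = A" using A S by (simp add: card_subset_eq)
      then show False using False by (simp add: R_def)
    qed
    have "card R \<le> card (ve ` X \<inter> A)" using A by (intro card_mono) (auto simp: R_def)
    then have rn: "card R \<le> ?n" using veX nK by simp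
    have npos: "0 < ?n" using rn False finX by (metis card_gt_0_iff le_zero_eq not_gr_zero)
    \<comment> \<open>One round, summed over all missed vehicles. The coefficient 2 is the
      acceptance threshold; the 4 arises because inserted edges are worth at most twice the gain and
      enter with that 2.\<close>
    have gain: "(\<Sum>F\<in>X2. w F) + 4 * card R * V j \<le> 2 * p * V ?n + 4 * card R * V (Suc j)"
      if j: "j < ?n" for j
    proof -
      let ?M = "build (B @ take j S)"
      \<comment> \<open>A trial insertion of \<open>i\<close> after \<open>j\<close> rounds. As
        \<open>i\<close> is never selected it is a candidate in this round, so the trial cannot end
        above \<open>V (Suc j)\<close>.\<close>
      have one: "(\<Sum>F\<in>{F\<in>X. ve F = i}. w F) + 4 * V j \<le>
          2 * (\<Sum>F\<in>{F\<in>X. ve F = i}. conflict_sum w conf ?M F) + 4 * V (Suc j)" if i: "i \<in> R" for i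
      proof -
        let ?X = "{F\<in>X. ve F = i}"
        have finX': "finite ?X" using X by simp
        obtain J where J: "set J \<subseteq> set (filter (\<lambda>F. ve F = i) E)"
          "2 * W ?M + W J \<le> 2 * W (add_vehicle w conf ve E ?M i)"
          "\<And>F. F \<in> set (filter (\<lambda>F. ve F = i) E) \<Longrightarrow>
             w F \<le> 2 * conflict_sum w conf ?M F + 2 * conflict_sum w conf J F"
          unfolding W_def add_vehicle_def
      by (rule insert_edges_inserted[where conf = conf and w = w and M = ?M and L = "filter (\<lambda>F. ve F = i) E",
            OF refl]) blast
        have "(\<Sum>F\<in>?X. w F) \<le> (\<Sum>F\<in>?X. 2 * conflict_sum w conf ?M F + 2 * conflict_sum w conf J F)"
          using J(3) X by (intro sum_mono) auto
        also have "\<dots> = 2 * (\<Sum>F\<in>?X. conflict_sum w conf ?M F) + 2 * (\<Sum>F\<in>?X. conflict_sum w conf J F)"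
          by (simp add: sum.distrib sum_distrib_left)
        also have "(\<Sum>F\<in>?X. conflict_sum w conf J F) \<le> 1 * W J"
          unfolding W_def
        proof (rule sum_conflict_sum_le[OF finX'])
          fix G assume "G \<in> set J"
          then have "G \<in> set E" using J(1) by auto
          from deg1[OF this, of i] show "card {F\<in>?X. conf F G} \<le> 1" by (simp add: conj_assoc)
        qed
        finally have "(\<Sum>F\<in>?X. w F) + 4 * W ?M \<le>
            2 * (\<Sum>F\<in>?X. conflict_sum w conf ?M F) + 4 * W (add_vehicle w conf ve E ?M i)"
          using J(2) by linarith
        moreover have "W (add_vehicle w conf ve E ?M i) \<le> V (Suc j)"
        proof -
          have "i \<in> A - set (take j S)" using i set_take_subset[of j S] by (auto simp: R_def)
          from greedy[OF j this] show ?thesis by (simp add: V_def build_def)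
        qed
        ultimately show ?thesis by (simp add: V_def)
      qed
      have part: "(\<Sum>F\<in>X2. h F) = (\<Sum>i\<in>R. \<Sum>F\<in>{F\<in>X. ve F = i}. h F)" for h :: "'e \<Rightarrow> nat"
      proof -
        have "(\<Sum>F\<in>X2. h F) = (\<Sum>i\<in>R. \<Sum>F\<in>{F\<in>X2. ve F = i}. h F)"
          using finX by (intro sum.group[symmetric]) (auto simp: X2_def)
        also have "\<dots> = (\<Sum>i\<in>R. \<Sum>F\<in>{F\<in>X. ve F = i}. h F)"
          by (intro sum.cong) (auto simp: X2_def)
        finally show ?thesis .
      qed
      have "(\<Sum>F\<in>X2. w F) + card R * (4 * V j) = (\<Sum>i\<in>R. (\<Sum>F\<in>{F\<in>X. ve F = i}. w F) + 4 * V j)"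
        by (simp add: part sum.distrib)
      also have "\<dots> \<le> (\<Sum>i\<in>R. 2 * (\<Sum>F\<in>{F\<in>X. ve F = i}. conflict_sum w conf ?M F) + 4 * V (Suc j))"
        by (intro sum_mono one)
      also have "\<dots> = 2 * (\<Sum>F\<in>X2. conflict_sum w conf ?M F) + card R * (4 * V (Suc j))"
        by (simp add: part sum.distrib sum_distrib_left)
      also have "(\<Sum>F\<in>X2. conflict_sum w conf ?M F) \<le> p * V j"
        unfolding V_def W_def
      proof (rule sum_conflict_sum_le[OF finX(2)])
        fix G assume "G \<in> set ?M"
        then have "G \<in> set E" using subE by auto
        have "card {F\<in>X2. conf F G} \<le> card {F\<in>X. conf F G}"
          using X by (intro card_mono) (auto simp: X2_def)
        then show "card {F\<in>X2. conf F G} \<le> p" using deg[OF \<open>G \<in> set E\<close>] by simp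
      qed
      also have "p * V j \<le> p * V ?n" using V_mono[of j] j by simp
      finally show ?thesis by (simp add: mult_ac)
    qed
    \<comment> \<open>The gains telescope over the rounds. With all \<open>?n\<close> rounds and
      \<open>card R\<close> at most \<open>?n\<close>, division by \<open>?n\<close> leaves the
      coefficient \<open>2 * p + 4\<close>, at most \<open>4 * p\<close> because \<open>p\<close> is
      at least 2.\<close>
    have "m * (\<Sum>F\<in>X2. w F) + 4 * card R * V 0 \<le> m * (2 * p * V ?n) + 4 * card R * V m"
      if "m \<le> ?n" for m using that
    proof (induction m)
      case (Suc m)
      then show ?case using gain[of m] by simp
    qed simp
    from this[of ?n] have "?n * (\<Sum>F\<in>X2. w F) \<le> ?n * (2 * p * V ?n) + 4 * card R * V ?n" by simp
    also have "\<dots> \<le> ?n * (2 * p * V ?n) + 4 * ?n * V ?n" using rn by simp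
    also have "\<dots> = ?n * ((2 * p + 4) * V ?n)" by (simp add: algebra_simps)
    finally have "(\<Sum>F\<in>X2. w F) \<le> (2 * p + 4) * V ?n" using npos by simp
    also have "\<dots> \<le> 4 * p * V ?n" using p by (intro mult_le_mono1) simp
    finally show ?thesis .
  qed
  finally show ?thesis by (simp add: V_n)
qed

section \<open>The algorithm\<close>

definition aug_names :: "dat \<Rightarrow> dat list" where
  "aug_names t = map left (els (left t))"

definition bas_names :: "dat \<Rightarrow> dat list" where
  "bas_names t = map left (els (left (right t)))"

definition bound :: "dat \<Rightarrow> nat" where
  "bound t = dn (left (right (right t)))"

definition scens :: "dat \<Rightarrow> dat" where
  "scens t = right (right (right t))"

text \<open>
  An item is a valued hyperedge tagged with its scenario. The tag is the number of scenarios from that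
  one onwards, so scenario \<open>k\<close> of \<open>N\<close> has tag \<open>N - k\<close>.
\<close>

definition items :: "dat \<Rightarrow> dat list" where
  "items t = concat (map (\<lambda>s. map (Node (nat_dat (length (els s)))) (els (right (left s))))
     (suffixes (scens t)))"

definition tag :: "dat \<Rightarrow> nat" where "tag F = dn (left F)"

definition edge_of :: "dat \<Rightarrow> dat" where "edge_of F = left (right F)"

definition vehicle_of :: "dat \<Rightarrow> nat" where "vehicle_of F = dn (left (edge_of F))"

definition num_of :: "dat \<Rightarrow> dat" where "num_of F = left (right (right F))"

definition den_of :: "dat \<Rightarrow> dat" where "den_of F = right (right (right F))"

definition conflicts :: "dat \<Rightarrow> dat \<Rightarrow> bool" where
  "conflicts F G \<longleftrightarrow> tag F = tag G \<and> (vehicle_of F = vehicle_of G \<or>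
     (\<exists>r\<in>set (els (right (edge_of F))). \<exists>r'\<in>set (els (right (edge_of G))). dn r = dn r'))"

definition scale :: "dat \<Rightarrow> dat list" where
  "scale t = concat (map (\<lambda>F. els (den_of F)) (items t))"

text \<open>
  With \<open>L = length (scale t)\<close> and binary lengths \<open>a\<close>, \<open>b\<close> of numerator and denominator, the weight is
  \<open>2 ^ (L - b + a)\<close>. The subtraction is not truncated for items of the instance, because \<open>L\<close> is the sum
  of all their denominator lengths.
\<close>

definition weight :: "dat \<Rightarrow> dat \<Rightarrow> nat" where
  "weight t F = 2 ^ length (drop (length (els (den_of F))) (scale t) @ els (num_of F))"

definition extend :: "dat \<Rightarrow> dat list \<Rightarrow> dat \<Rightarrow> dat list" where
  "extend t M i = add_vehicle (weight t) conflicts vehicle_of (items t) M (dn i)"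

definition build :: "dat \<Rightarrow> dat list \<Rightarrow> dat list" where
  "build t S = foldl (extend t) [] (bas_names t @ S)"

definition gross :: "dat \<Rightarrow> dat list \<Rightarrow> nat" where
  "gross t S = (\<Sum>F\<leftarrow>build t S. weight t F)"

text \<open>\<open>Leaf\<close> means that no candidate is left. The winner is wrapped in a
  \<open>Node\<close>, because the vehicle named 0 is itself encoded by \<open>Leaf\<close>.\<close>

definition pick :: "dat \<Rightarrow> dat list \<Rightarrow> dat" where
  "pick t S = foldl (\<lambda>b a. if \<exists>s\<in>set S. dn s = dn a then b
     else if b = Leaf \<or> gross t (S @ [left b]) < gross t (S @ [a]) then Node a Leaf else b)
     Leaf (aug_names t)"

text \<open>The list of augmented names only counts rounds. Iterating up to the budget could take
  exponential time, and no more rounds than there are augmented vehicles are of use.\<close>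

definition select :: "dat \<Rightarrow> dat list" where
  "select t = foldl (\<lambda>S _. if length S < bound t \<and> pick t S \<noteq> Leaf then S @ [left (pick t S)] else S)
     [] (aug_names t)"

text \<open>The suffix that starts at scenario \<open>k\<close> has length \<open>N - k\<close>,
  which is the tag of the items of that scenario. Edges are output as the very subtrees read from
  the input.\<close>

definition solve :: "dat \<Rightarrow> dat" where
  "solve t = Node (list_dat (select t))
     (list_dat (map (\<lambda>s. list_dat (map edge_of
        (filter (\<lambda>F. tag F = length (els s)) (build t (select t))))) (suffixes (scens t))))"

section \<open>Polynomial running time of the components of the algorithm\<close>

lemmas PT_intros = PT_Node PT_Leaf PT_left PT_right PT_id PT_nat_dat PT_list_dat PTL_els
  PTL_Nil PTL_Cons PTL_append PTL_suffixes PTL_if PT_if PTL_drop PTN_const PTN_dn PTN_add PTN_length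
  PTN_power2_length PTB_le PTB_less PTB_nat_eq PTB_conj PTB_disj PTB_not PTB_eq_Leaf PTB_neq_Leaf

lemma PT_accessors:
  assumes "PT f"
  shows "PT (\<lambda>x. edge_of (f x))" "PT (\<lambda>x. num_of (f x))" "PT (\<lambda>x. den_of (f x))"
    "PT (\<lambda>x. scens (f x))" "PTN (\<lambda>x. tag (f x))" "PTN (\<lambda>x. vehicle_of (f x))" "PTN (\<lambda>x. bound (f x))"
  unfolding edge_of_def num_of_def den_of_def scens_def tag_def vehicle_of_def bound_def
  by (intro PT_intros assms)+

lemma PTL_comp: "PTL g \<Longrightarrow> PT f \<Longrightarrow> PTL (\<lambda>x. g (f x))"
  unfolding PTL_def by (rule PT_comp[of "\<lambda>x. list_dat (g x)"])

lemma PTL_aug_names: assumes "PT f" shows "PTL (\<lambda>x. aug_names (f x))"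
proof (rule PTL_comp[of aug_names, OF _ assms])
  show "PTL aug_names" unfolding aug_names_def[abs_def] by (intro PTL_map PT_intros)
qed

lemma PTL_bas_names: assumes "PT f" shows "PTL (\<lambda>x. bas_names (f x))"
proof (rule PTL_comp[of bas_names, OF _ assms])
  show "PTL bas_names" unfolding bas_names_def[abs_def] by (intro PTL_map PT_intros)
qed

lemma PTL_items: assumes "PT f" shows "PTL (\<lambda>x. items (f x))"
proof (rule PTL_comp[of items, OF _ assms])
  show "PTL items" unfolding items_def[abs_def]
    by (intro PTL_concat_map PTL_map PT_intros PT_accessors)
qed

lemma PTL_scale: assumes "PT f" shows "PTL (\<lambda>x. scale (f x))"
proof (rule PTL_comp[of scale, OF _ assms])
  show "PTL scale" unfolding scale_def[abs_def]
    by (intro PTL_concat_map PTL_items PT_intros PT_accessors)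
qed

lemma PTN_weight: "PT f \<Longrightarrow> PT g \<Longrightarrow> PTN (\<lambda>x. weight (f x) (g x))"
  unfolding weight_def by (intro PTL_scale PT_intros PT_accessors)

lemma PTB_comp2:
  assumes "PTB (\<lambda>z. h (left z) (right z))" "PT f" "PT g" shows "PTB (\<lambda>x. h (f x) (g x))"
  using PT_comp[OF assms(1)[unfolded PTB_def] PT_Node[OF assms(2,3)]] unfolding PTB_def by simp

lemma PTB_conflicts: assumes "PT f" "PT g" shows "PTB (\<lambda>x. conflicts (f x) (g x))"
proof (rule PTB_comp2[OF _ assms])
  show "PTB (\<lambda>z. conflicts (left z) (right z))" unfolding conflicts_def
    by (intro PTB_bex PT_intros PT_accessors)
qed

lemma PTL_insert_edge:
  "PTL (\<lambda>z. insert_edge (weight (left z)) conflicts (els (left (right z))) (right (right z)))"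
  \<comment> \<open>Doubling is rewritten as a sum because addition is the available arithmetic
    operation.\<close>
  unfolding insert_edge_def conflict_sum_def mult_2
  by (intro PTN_sum_list PTN_weight PTL_filter PTB_conflicts PT_intros)

lemma size_insert_edge: "size (list_dat (insert_edge w conf M F)) \<le> size (list_dat M) + (size F + 1)"
  using sum_list_filter_le[of "\<lambda>a. Suc (size a)" "\<lambda>G. \<not> conf F G" M]
  by (simp add: insert_edge_def size_list_dat)

lemma size_foldl_insert_edge:
  "size (list_dat (foldl (insert_edge w conf) M L)) \<le> size (list_dat M) + size (list_dat L)"
proof (induction L arbitrary: M)
  case (Cons F L)
  show ?case using Cons[of "insert_edge w conf M F"] size_insert_edge[of w conf M F] by simp
qed simp

lemma size_filter: "size (list_dat (filter P L)) \<le> size (list_dat L)"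
  using sum_list_filter_le[of "\<lambda>a. size a + 1" P L] by (simp add: size_list_dat)

lemma PTL_extend: assumes "PT f" "PTL g" "PT h" shows "PTL (\<lambda>x. extend (f x) (g x) (h x))"
proof -
  have "PTL (\<lambda>z. extend (left z) (els (left (right z))) (right (right z)))"
    unfolding extend_def add_vehicle_def
  proof (rule PTL_foldl)
    show "PTL (\<lambda>x. els (left (right x)))" by (intro PT_intros)
    show "PTL (\<lambda>x. filter (\<lambda>F. vehicle_of F = dn (right (right x))) (items (left x)))"
      by (intro PTL_filter PTL_items PT_intros PT_accessors)
    show "PTL (\<lambda>z. insert_edge (weight (left (left z))) conflicts (els (left (right z))) (right (right z)))"
      using PTL_comp[OF PTL_insert_edge, of "\<lambda>z. Node (left (left z)) (Node (left (right z)) (right (right z)))"]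
      by (simp add: PT_Node PT_left PT_right PT_id)
    show "pbounded (\<lambda>n. n + 1)" by (intro pbounded_intros)
    show "size (list_dat (insert_edge (weight (left x)) conflicts acc a)) \<le>
      size (list_dat acc) + (size x + size a + 1)" for x acc a
      using size_insert_edge[of "weight (left x)" conflicts acc a] by simp
  qed
  from PTL_comp[OF this PT_Node[OF assms(1) PT_Node[OF PT_list_dat[OF assms(2)] assms(3)]]]
  show ?thesis by simp
qed

text \<open>Processing one vehicle lengthens the held list by at most the size of the item list,
  whatever is held already. The outer iteration thus grows additively although each of its steps is
  itself an iteration.\<close>

lemma PTL_build: assumes "PT f" "PTL g" shows "PTL (\<lambda>x. build (f x) (g x))"
proof -
  obtain b where b: "pbounded b" "\<And>t. size (list_dat (items t)) \<le> b (size t)"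
    using PTL_items[OF PT_id] PT_size unfolding PTL_def by blast
  have "PTL (\<lambda>z. build (left z) (els (right z)))"
    unfolding build_def
  proof (rule PTL_foldl[OF PTL_Nil])
    show "PTL (\<lambda>x. bas_names (left x) @ els (right x))"
      by (intro PTL_bas_names PT_intros)
    show "PTL (\<lambda>z. extend (left (left z)) (els (left (right z))) (right (right z)))"
      by (intro PTL_extend PT_intros)
    show "pbounded b" by (rule b)
    fix x acc a
    have "size (list_dat (extend (left x) acc a)) \<le> size (list_dat acc) + size (list_dat (items (left x)))"
      unfolding extend_def add_vehicle_def
      by (rule order_trans[OF size_foldl_insert_edge add_left_mono[OF size_filter]])
    also have "size (list_dat (items (left x))) \<le> b (size x + size a)"
      using b(2)[of "left x"] pbounded_mono[OF b(1), of "size (left x)" "size x + size a"]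
        size_left[of x] by linarith
    finally show "size (list_dat (extend (left x) acc a)) \<le> size (list_dat acc) + b (size x + size a)"
      by simp
  qed
  from PTL_comp[OF this PT_Node[OF assms(1) PT_list_dat[OF assms(2)]]] show ?thesis by simp
qed

lemma PTN_gross: assumes "PT f" "PTL g" shows "PTN (\<lambda>x. gross (f x) (g x))"
proof -
  have "PTN (\<lambda>z. gross (left z) (els (right z)))"
    unfolding gross_def by (intro PTN_sum_list PTN_weight PTL_build PT_intros)
  from PTN_comp2[OF this assms(1) PT_list_dat[OF assms(2)]] show ?thesis by simp
qed

lemma PT_pick: assumes "PT f" "PTL g" shows "PT (\<lambda>x. pick (f x) (g x))"
proof -
  have "PT (\<lambda>z. pick (left z) (els (right z)))"
    unfolding pick_def
  proof (rule PT_foldl)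
    show "PT (\<lambda>_. Leaf)" "PTL (\<lambda>x. aug_names (left x))" by (intro PTL_aug_names PT_intros)+
    show "PT (\<lambda>z. if \<exists>s\<in>set (els (right (left z))). dn s = dn (right (right z)) then left (right z)
        else if left (right z) = Leaf \<or>
          gross (left (left z)) (els (right (left z)) @ [left (left (right z))]) <
          gross (left (left z)) (els (right (left z)) @ [right (right z)])
        then Node (right (right z)) Leaf else left (right z))"
      by (intro PTB_bex PTN_gross PT_intros)
    show "pbounded (\<lambda>n. n + 1)" by (intro pbounded_intros)
  qed simp
  from PT_comp[OF this PT_Node[OF assms(1) PT_list_dat[OF assms(2)]]] show ?thesis by simp
qed

lemma pick_cases:
  obtains (none) "pick t S = Leaf" "\<And>a. a \<in> set (aug_names t) \<Longrightarrow> \<exists>s\<in>set S. dn s = dn a"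
  | (some) a where "pick t S = Node a Leaf" "a \<in> set (aug_names t)" "\<not> (\<exists>s\<in>set S. dn s = dn a)"
      "\<And>a'. a' \<in> set (aug_names t) \<Longrightarrow> \<not> (\<exists>s\<in>set S. dn s = dn a') \<Longrightarrow>
         gross t (S @ [a']) \<le> gross t (S @ [a])"
proof -
  let ?step = "\<lambda>b a. if \<exists>s\<in>set S. dn s = dn a then b
     else if b = Leaf \<or> gross t (S @ [left b]) < gross t (S @ [a]) then Node a Leaf else b"
  have "(foldl ?step Leaf xs = Leaf \<and> (\<forall>a\<in>set xs. \<exists>s\<in>set S. dn s = dn a)) \<or>
    (\<exists>a. foldl ?step Leaf xs = Node a Leaf \<and> a \<in> set xs \<and> \<not> (\<exists>s\<in>set S. dn s = dn a) \<and>
      (\<forall>a'\<in>set xs. \<not> (\<exists>s\<in>set S. dn s = dn a') \<longrightarrow> gross t (S @ [a']) \<le> gross t (S @ [a])))" for xs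
  proof (induction xs rule: rev_induct)
    case (snoc x xs)
    then show ?case
    proof (elim disjE exE conjE, goal_cases)
      case 1 then show ?case by (cases "\<exists>s\<in>set S. dn s = dn x") auto
    next
      case (2 a)
      show ?case
      proof (cases "\<exists>s\<in>set S. dn s = dn x")
        case True
        then show ?thesis using 2 by auto
      next
        case x: False
        show ?thesis
        proof (cases "gross t (S @ [a]) < gross t (S @ [x])")
          case True
          then have "foldl ?step Leaf (xs @ [x]) = Node x Leaf" using 2 x by auto
          moreover have "\<forall>a'\<in>set (xs @ [x]). \<not> (\<exists>s\<in>set S. dn s = dn a') \<longrightarrow>
              gross t (S @ [a']) \<le> gross t (S @ [x])"
            using 2(4) True by (fastforce intro: order_trans less_imp_le)
          ultimately show ?thesis using x by auto
        next
          case False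
          then have "foldl ?step Leaf (xs @ [x]) = Node a Leaf" using 2 x by auto
          then show ?thesis using 2 False by (auto simp: not_less)
        qed
      qed
    qed
  qed simp
  from this[of "aug_names t"] show ?thesis
    using that unfolding pick_def by blast
qed

lemma PTL_select: assumes "PT f" shows "PTL (\<lambda>x. select (f x))"
proof (rule PTL_comp[OF _ assms])
  obtain b where b: "pbounded b" "\<And>t. size (list_dat (aug_names t)) \<le> b (size t)"
    using PTL_aug_names[OF PT_id] PT_size unfolding PTL_def by blast
  show "PTL select"
    unfolding select_def[abs_def]
  proof (rule PTL_foldl)
    show "PTL (\<lambda>_. [])" "PTL aug_names" using PTL_aug_names[OF PT_id] by (auto intro: PT_intros)
    show "PTL (\<lambda>z. if length (els (left (right z))) < bound (left z) \<and>
          pick (left z) (els (left (right z))) \<noteq> Leaf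
        then els (left (right z)) @ [left (pick (left z) (els (left (right z))))]
        else els (left (right z)))"
      by (intro PT_pick PT_accessors PT_intros)
    show "pbounded (\<lambda>n. b n + 1)" by (intro pbounded_intros b)
    fix x S and a :: dat
    \<comment> \<open>The picked name occurs in the input, which bounds it independently of
      \<open>S\<close>. The size bound that comes with \<open>PT_pick\<close> would depend on
      \<open>S\<close> and could not be iterated.\<close>
    have "size (left (pick x S)) \<le> b (size x)"
    proof (cases x S rule: pick_cases)
      case (some a)
      then show ?thesis using size_els[of a "list_dat (aug_names x)"] b(2)[of x] by simp
    qed simp
    also have "\<dots> \<le> b (size x + size a)" by (intro pbounded_mono[OF b(1)]) simp
    finally show "size (list_dat (if length S < bound x \<and> pick x S \<noteq> Leaf
        then S @ [left (pick x S)] else S)) \<le> size (list_dat S) + (b (size x + size a) + 1)"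
      by (simp add: size_list_dat)
  qed
qed

lemma PT_solve: "PT solve"
proof -
  have "PTL (\<lambda>x. map (\<lambda>s. list_dat (map edge_of (filter (\<lambda>F. tag F = length (els s))
      (build x (select x))))) (suffixes (scens x)))"
    by (intro PTL_map PTL_filter PTL_build PTL_select PT_intros PT_accessors)
  then show ?thesis unfolding solve_def[abs_def]
    by (intro PT_Node PT_list_dat PTL_select PT_id)
qed

section \<open>Correctness\<close>

definition decode_edge :: "dat \<Rightarrow> hyperedge" where
  "decode_edge u = (dn (left u), dn ` set (els (right u)))"

definition hyperedge_of :: "dat \<Rightarrow> hyperedge" where
  "hyperedge_of F = decode_edge (edge_of F)"

lemma conflicts_iff: "conflicts F G \<longleftrightarrow>
    tag F = tag G \<and> \<not> disjoint_edges (hyperedge_of F) (hyperedge_of G)"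
  by (fastforce simp: conflicts_def disjoint_edges_def hyperedge_of_def decode_edge_def vehicle_of_def)

lemma decode_edge_code: assumes "edge_code f u" shows "decode_edge u = f"
proof -
  obtain xs ts where 1: "set xs = snd f" "list_all2 nat_code xs ts" "u = Node (nat_dat (fst f)) (list_dat ts)"
    using assms unfolding edge_code_def set_code_def by blast
  have "ts = map nat_dat xs" using 1(2) by (induction) (auto simp: nat_code_def)
  then show ?thesis using 1 by (simp add: decode_edge_def image_image)
qed

lemma labelled_names:
  assumes "list_all2 (labelled_nat_code c) xs ts" shows "map left ts = map nat_dat xs"
  using assms by (induction) (auto simp: labelled_nat_code_def)

lemma suffixes_list_dat: "suffixes (list_dat ts) = map (\<lambda>k. list_dat (drop k ts)) [0..<length ts]"
proof (induction ts)
  case (Cons a ts)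
  have "[0..<length (a # ts)] = 0 # map Suc [0..<length ts]"
    by (simp add: map_Suc_upt upt_conv_Cons del: upt_Suc)
  then show ?case using Cons by (simp add: o_def del: upt_Suc)
qed simp

lemma select_greedy:
  assumes as: "distinct as" "aug_names t = map nat_dat as"
  obtains S where "select t = map nat_dat S" "distinct S" "set S \<subseteq> set as"
    "length S = min (bound t) (length as)"
    "\<And>j i. j < length S \<Longrightarrow> i \<in> set as - set (take j S) \<Longrightarrow>
      gross t (map nat_dat (take j S @ [i])) \<le> gross t (map nat_dat (take (Suc j) S))"
proof -
  let ?step = "\<lambda>S _. if length S < bound t \<and> pick t S \<noteq> Leaf then S @ [left (pick t S)] else S"
  have "\<exists>S. foldl ?step [] ys = map nat_dat S \<and> distinct S \<and> set S \<subseteq> set as \<and>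
     length S = min (bound t) (length ys) \<and>
     (\<forall>j<length S. \<forall>i\<in>set as - set (take j S).
       gross t (map nat_dat (take j S @ [i])) \<le> gross t (map nat_dat (take (Suc j) S)))"
    if "length ys \<le> length as" for ys :: "dat list"
    using that
  proof (induction ys rule: rev_induct)
    case (snoc y ys)
    then obtain S where S: "foldl ?step [] ys = map nat_dat S" "distinct S" "set S \<subseteq> set as"
      "length S = min (bound t) (length ys)"
      "\<And>j i. j < length S \<Longrightarrow> i \<in> set as - set (take j S) \<Longrightarrow>
        gross t (map nat_dat (take j S @ [i])) \<le> gross t (map nat_dat (take (Suc j) S))" by auto
    show ?case
    proof (cases "length S < bound t")
      case False
      then show ?thesis using S by (intro exI[of _ S]) auto
    next
      case True
      have not_all: "\<not> set as \<subseteq> set S"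
      proof
        assume "set as \<subseteq> set S"
        then have "length as \<le> length S"
          using as(1) S(2) card_mono[of "set S" "set as"] by (simp add: distinct_card)
        then show False using S(4) snoc.prems by simp
      qed
      show ?thesis
      proof (cases t "map nat_dat S" rule: pick_cases)
        case none
        have "set as \<subseteq> set S"
        proof
          fix i assume "i \<in> set as"
          then show "i \<in> set S" using none(2)[of "nat_dat i"] as(2) by auto
        qed
        then show ?thesis using not_all by blast
      next
        case (some a)
        then obtain i where i: "a = nat_dat i" "i \<in> set as" "i \<notin> set S" using as(2) by auto
        have max: "gross t (map nat_dat (S @ [i'])) \<le> gross t (map nat_dat (S @ [i]))"
          if "i' \<in> set as - set S" for i'
          using some(4)[of "nat_dat i'"] that as(2) i by auto
        have "foldl ?step [] (ys @ [y]) = map nat_dat (S @ [i])"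
          using S(1) True some(1) i by simp
        moreover have "gross t (map nat_dat (take j (S @ [i]) @ [i'])) \<le>
            gross t (map nat_dat (take (Suc j) (S @ [i])))"
          if "j < length (S @ [i])" "i' \<in> set as - set (take j (S @ [i]))" for j i'
        proof (cases "j = length S")
          case True
          then show ?thesis using max that by simp
        next
          case False
          then show ?thesis using S(5)[of j i'] that by simp
        qed
        moreover have "length (S @ [i]) = min (bound t) (length (ys @ [y]))" using S(4) True by simp
        ultimately show ?thesis using S i by (intro exI[of _ "S @ [i]"]) auto
      qed
    qed
  qed simp
  from this[of "aug_names t"] show ?thesis
    using that as(2) unfolding select_def by auto
qed

lemma build_eq_foldl:
  assumes "bas_names t = map nat_dat bs"
  shows "build t (map nat_dat S) =
    foldl (add_vehicle (weight t) conflicts vehicle_of (items t)) [] (bs @ S)"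
proof -
  have "foldl (extend t) M (map nat_dat vs) =
      foldl (add_vehicle (weight t) conflicts vehicle_of (items t)) M vs" for M vs
    by (induction vs arbitrary: M) (auto simp: extend_def)
  from this[of "[]" "bs @ S"] show ?thesis by (simp add: build_def assms)
qed

text \<open>Numerator and denominator are both rounded up by a factor of at most two. In the
  quotient these errors act in opposite directions, so the scaled value is met within a factor of
  two on either side.\<close>

lemma weight_bounds:
  assumes F: "F \<in> set (items t)" and n: "num_of F = nat_dat n" "n > 0"
    and d: "den_of F = nat_dat d" "d > 0"
  shows "2 ^ length (scale t) * (real n / real d) \<le> 2 * real (weight t F)"
    "real (weight t F) \<le> 2 * (2 ^ length (scale t) * (real n / real d))"
proof -
  have "length (els (den_of F)) \<le> length (scale t)"
    using F member_le_sum_list[of "length (els (den_of F))" "map (\<lambda>F. length (els (den_of F))) (items t)"]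
    by (simp add: scale_def length_concat o_def)
  then have le: "nlen d \<le> length (scale t)" by (simp add: d nlen_def)
  have "real (weight t F) = 2 ^ (length (scale t) - nlen d) * 2 ^ nlen n"
    by (simp add: weight_def n d nlen_def power_add)
  also have "\<dots> = 2 ^ length (scale t) * (2 ^ nlen n / 2 ^ nlen d)"
    using power_diff[of "2::real" "nlen d" "length (scale t)"] le by simp
  finally have w: "real (weight t F) = 2 ^ length (scale t) * (2 ^ nlen n / 2 ^ nlen d)" .
  have "real n \<le> real (2 ^ nlen n)" "real (2 ^ nlen n) \<le> real (2 * n)"
    using nlen_less[of n] nlen_ge[OF n(2)] by (simp_all only: of_nat_le_iff less_imp_le)
  then have nb: "real n \<le> 2 ^ nlen n" "2 ^ nlen n \<le> 2 * real n" by simp_all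
  have "real d \<le> real (2 ^ nlen d)" "real (2 ^ nlen d) \<le> real (2 * d)"
    using nlen_less[of d] nlen_ge[OF d(2)] by (simp_all only: of_nat_le_iff less_imp_le)
  then have db: "real d \<le> 2 ^ nlen d" "2 ^ nlen d \<le> 2 * real d" by simp_all
  have "real n / real d = 2 * (real n / (2 * real d))" by simp
  also have "\<dots> \<le> 2 * (2 ^ nlen n / 2 ^ nlen d)"
    using nb db d by (intro mult_left_mono frac_le) auto
  finally have "2 ^ length (scale t) * (real n / real d) \<le>
      2 ^ length (scale t) * (2 * (2 ^ nlen n / 2 ^ nlen d))" by (rule mult_left_mono) simp
  then show "2 ^ length (scale t) * (real n / real d) \<le> 2 * real (weight t F)"
    unfolding w by (simp only: mult.left_commute[of _ 2])
  have "(2::real) ^ nlen n / 2 ^ nlen d \<le> 2 * real n / real d"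
    using nb db d by (intro frac_le) auto
  also have "\<dots> = 2 * (real n / real d)" by simp
  finally have "(2::real) ^ length (scale t) * (2 ^ nlen n / 2 ^ nlen d) \<le>
      2 ^ length (scale t) * (2 * (real n / real d))" by (rule mult_left_mono) simp
  then show "real (weight t F) \<le> 2 * (2 ^ length (scale t) * (real n / real d))"
    unfolding w by (simp only: mult.left_commute[of _ 2])
qed

lemma of_rat_quotient:
  assumes "q > 0"
  shows "real_of_rat q = real (nat (fst (quotient_of q))) / real (nat (snd (quotient_of q)))"
    "nat (fst (quotient_of q)) > 0" "nat (snd (quotient_of q)) > 0"
proof -
  obtain n d where nd: "quotient_of q = (n, d)" by fastforce
  have d: "d > 0" using quotient_of_denom_pos[OF nd] .
  have q: "q = of_int n / of_int d" using quotient_of_div[OF nd] .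
  then have n: "n > 0" using assms d by (simp add: zero_less_divide_iff)
  show "nat (fst (quotient_of q)) > 0" "nat (snd (quotient_of q)) > 0" using n d nd by auto
  show "real_of_rat q = real (nat (fst (quotient_of q))) / real (nat (snd (quotient_of q)))"
    unfolding nd using n d by (subst q) (simp add: of_rat_divide)
qed

text \<open>A hyperedge has a code for every order of its requests, but the code of a set lists each
  member once; hence decoding is injective on the listed trees.\<close>

lemma valued_edges:
  assumes "set_code (valued_edge_code v) H e"
  shows "bij_betw (\<lambda>g. decode_edge (left g)) (set (els e)) H"
    "\<And>g. g \<in> set (els e) \<Longrightarrow> edge_code (decode_edge (left g)) (left g) \<and>
       right g = rat_dat (v (decode_edge (left g)))"
proof -
  obtain xs ts where 1: "distinct xs" "set xs = H" "list_all2 (valued_edge_code v) xs ts" "e = list_dat ts"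
    using assms unfolding set_code_def by blast
  from 1(3) have 2: "map (\<lambda>g. decode_edge (left g)) ts = xs \<and>
     (\<forall>g\<in>set ts. edge_code (decode_edge (left g)) (left g) \<and> right g = rat_dat (v (decode_edge (left g))))"
    by induction (auto simp: valued_edge_code_def decode_edge_code)
  then show "\<And>g. g \<in> set (els e) \<Longrightarrow> edge_code (decode_edge (left g)) (left g) \<and>
       right g = rat_dat (v (decode_edge (left g)))" using 1(4) by simp
  have "distinct (map (\<lambda>g. decode_edge (left g)) ts)" using 1(1) 2 by simp
  then show "bij_betw (\<lambda>g. decode_edge (left g)) (set (els e)) H"
    using 1 2 by (auto simp: bij_betw_def distinct_map)
qed

lemma edge_bound_ge_2:
  assumes "wf_sramf I" shows "2 \<le> edge_bound I"
proof -
  obtain i where i: "i \<in> vehicles I" using assms by (auto simp: wf_sramf_def)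
  then have "1 \<le> capacity I i" using assms by (auto simp: wf_sramf_def)
  also have "\<dots> \<le> Max (capacity I ` vehicles I)"
    using i assms by (intro Max_ge) (auto simp: wf_sramf_def vehicles_def)
  finally show ?thesis by (simp add: edge_bound_def)
qed

section \<open>A well-formed instance together with one of its encodings\<close>

locale encoded_sramf =
  fixes I :: sramf and t :: dat
  assumes wf: "wf_sramf I" and code: "sramf_code I t"
begin

abbreviation "N \<equiv> length (scenarios I)"
abbreviation "\<xi> k \<equiv> scenarios I ! k"

lemma scens_code:
  obtains ts where "list_all2 scenario_code (scenarios I) ts" "scens t = list_dat ts"
  using code unfolding sramf_code_def list_code_def scens_def by auto

lemma names:
  obtains as bs where "distinct as" "set as = augmented I" "aug_names t = map nat_dat as"
    "set bs = basis I" "bas_names t = map nat_dat bs" "bound t = budget I"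
proof -
  obtain a b x where t: "set_code (labelled_nat_code (capacity I)) (augmented I) a"
    "set_code (labelled_nat_code (capacity I)) (basis I) b" "t = Node a (Node b (Node (nat_dat (budget I)) x))"
    using code unfolding sramf_code_def by blast
  obtain as ta where a: "distinct as" "set as = augmented I" "list_all2 (labelled_nat_code (capacity I)) as ta"
    "a = list_dat ta" using t(1) unfolding set_code_def by blast
  obtain bs tb where b: "set bs = basis I" "list_all2 (labelled_nat_code (capacity I)) bs tb"
    "b = list_dat tb" using t(2) unfolding set_code_def by blast
  show ?thesis
    by (rule that[of as bs])
      (use t(3) a b labelled_names[OF a(3)] labelled_names[OF b(2)] in
        \<open>simp_all add: aug_names_def bas_names_def bound_def\<close>)
qed

lemma items_spec:
  "set (items t) = (\<Union>k<N. {F \<in> set (items t). tag F = N - k})"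
  "\<And>k. k < N \<Longrightarrow> bij_betw hyperedge_of {F \<in> set (items t). tag F = N - k} (hyperedges (\<xi> k))"
  "\<And>F k. F \<in> set (items t) \<Longrightarrow> k < N \<Longrightarrow> tag F = N - k \<Longrightarrow>
     edge_code (hyperedge_of F) (edge_of F) \<and> right (right F) = rat_dat (val (\<xi> k) (hyperedge_of F))"
proof -
  obtain ts where ts: "list_all2 scenario_code (scenarios I) ts" "scens t = list_dat ts"
    by (rule scens_code)
  have len: "length ts = N" using ts(1) by (simp add: list_all2_lengthD)
  let ?E = "\<lambda>k. set (els (right (ts ! k)))"
  have hd: "left (list_dat (drop k ts)) = ts ! k" if "k < N" for k
    using that len by (cases "drop k ts") (simp_all, metis hd_drop_conv_nth list.sel(1))
  have set_items: "set (items t) = (\<Union>k<N. Node (nat_dat (N - k)) ` ?E k)"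
    unfolding items_def ts(2) suffixes_list_dat
    by (auto simp: len hd)
  \<comment> \<open>Subtraction on natural numbers is injective here only because both indices are
    below \<open>N\<close>; so tags identify scenarios by position, even if equal scenarios are
    repeated.\<close>
  have inj: "j = k" if "N - j = N - k" "j < N" "k < N" for j k using that by arith
  have sel: "{F \<in> set (items t). tag F = N - k} = Node (nat_dat (N - k)) ` ?E k" if "k < N" for k
  proof (intro equalityI subsetI)
    fix F assume F: "F \<in> {F \<in> set (items t). tag F = N - k}"
    then have "F \<in> (\<Union>k<N. Node (nat_dat (N - k)) ` ?E k)" using set_items by blast
    then obtain j g where j: "j < N" "g \<in> ?E j" "F = Node (nat_dat (N - j)) g" by blast
    have "N - j = N - k" using F j(3) by (simp add: tag_def)
    then have "j = k" using j(1) that by (rule inj)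
    then show "F \<in> Node (nat_dat (N - k)) ` ?E k" using j by simp
  qed (use that in \<open>auto simp: set_items tag_def\<close>)
  have vc: "set_code (valued_edge_code (val (\<xi> k))) (hyperedges (\<xi> k)) (right (ts ! k))" if "k < N" for k
    using list_all2_nthD[OF ts(1) that] unfolding scenario_code_def by auto
  show "set (items t) = (\<Union>k<N. {F \<in> set (items t). tag F = N - k})"
  proof (intro equalityI subsetI)
    fix F assume "F \<in> set (items t)"
    then have "F \<in> (\<Union>k<N. Node (nat_dat (N - k)) ` ?E k)" using set_items by blast
    then obtain k where k: "k < N" "F \<in> Node (nat_dat (N - k)) ` ?E k" by blast
    then have "F \<in> {F \<in> set (items t). tag F = N - k}" using sel by blast
    then show "F \<in> (\<Union>k<N. {F \<in> set (items t). tag F = N - k})" using k by blast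
  qed blast
  show "bij_betw hyperedge_of {F \<in> set (items t). tag F = N - k} (hyperedges (\<xi> k))" if "k < N" for k
  proof -
    have "bij_betw (\<lambda>g. hyperedge_of (Node (nat_dat (N - k)) g)) (?E k) (hyperedges (\<xi> k))"
      using valued_edges(1)[OF vc[OF that]] by (simp add: hyperedge_of_def edge_of_def)
    then show ?thesis unfolding sel[OF that]
      by (auto simp: bij_betw_def inj_on_def image_image)
  qed
  show "edge_code (hyperedge_of F) (edge_of F) \<and> right (right F) = rat_dat (val (\<xi> k) (hyperedge_of F))"
    if F: "F \<in> set (items t)" and k: "k < N" and "tag F = N - k" for F k
  proof -
    have "F \<in> {F \<in> set (items t). tag F = N - k}" using that by simp
    then obtain g where g: "F = Node (nat_dat (N - k)) g" "g \<in> ?E k" unfolding sel[OF k] by blast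
    then show ?thesis using valued_edges(2)[OF vc[OF k] g(2)]
      by (simp add: hyperedge_of_def edge_of_def)
  qed
qed

text \<open>A tag has the form \<open>N - k\<close> with \<open>k < N\<close>, so
  \<open>N - tag F\<close> recovers the index of the scenario.\<close>

definition item_value :: "dat \<Rightarrow> real" where
  "item_value F = of_rat (val (\<xi> (N - tag F)) (hyperedge_of F))"

lemma item_index:
  assumes "F \<in> set (items t)"
  shows "N - tag F < N" "tag F = N - (N - tag F)" "hyperedge_of F \<in> hyperedges (\<xi> (N - tag F))"
    "edge_code (hyperedge_of F) (edge_of F)"
    "right (right F) = rat_dat (val (\<xi> (N - tag F)) (hyperedge_of F))"
proof -
  obtain k where k: "k < N" "tag F = N - k" using items_spec(1) assms by blast
  then have eq: "N - tag F = k" by simp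
  show "N - tag F < N" "tag F = N - (N - tag F)" using k eq by simp_all
  show "hyperedge_of F \<in> hyperedges (\<xi> (N - tag F))"
    using items_spec(2)[OF k(1)] assms k eq by (auto simp: bij_betw_def)
  show "edge_code (hyperedge_of F) (edge_of F)"
    "right (right F) = rat_dat (val (\<xi> (N - tag F)) (hyperedge_of F))"
    using items_spec(3)[OF assms k] eq by auto
qed

lemma item_inject:
  assumes "F \<in> set (items t)" "G \<in> set (items t)" "tag F = tag G" "hyperedge_of F = hyperedge_of G"
  shows "F = G"
  using items_spec(2)[OF item_index(1)[OF assms(1)]] item_index(2)[OF assms(1)] assms
  by (auto simp: bij_betw_def inj_on_def)

lemma sum_item_value:
  assumes "Y \<subseteq> set (items t)"
  shows "(\<Sum>F\<in>Y. item_value F) =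
    (\<Sum>k<N. total_value (\<xi> k) (hyperedge_of ` {F\<in>Y. tag F = N - k}))"
proof -
  have fin: "finite Y" using assms finite_subset by blast
  have "(\<Sum>F\<in>Y. item_value F) = (\<Sum>k<N. \<Sum>F\<in>{F\<in>Y. N - tag F = k}. item_value F)"
    using fin item_index(1) assms by (intro sum.group[symmetric]) auto
  also have "\<dots> = (\<Sum>k<N. total_value (\<xi> k) (hyperedge_of ` {F\<in>Y. tag F = N - k}))"
  proof (rule sum.cong[OF refl])
    fix k assume "k \<in> {..<N}"
    then have k: "k < N" by simp
    have eq: "{F\<in>Y. N - tag F = k} = {F\<in>Y. tag F = N - k}"
    proof (intro Collect_cong conj_cong refl)
      fix F assume "F \<in> Y"
      then have "tag F = N - (N - tag F)" using item_index(2) assms by blast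
      then show "N - tag F = k \<longleftrightarrow> tag F = N - k" using k by arith
    qed
    have inj: "inj_on hyperedge_of {F\<in>Y. tag F = N - k}"
      by (rule inj_onI, rule item_inject) (use assms in auto)
    show "(\<Sum>F\<in>{F\<in>Y. N - tag F = k}. item_value F) =
        total_value (\<xi> k) (hyperedge_of ` {F\<in>Y. tag F = N - k})"
      unfolding eq total_value_def sum.reindex[OF inj] o_def
      using k by (intro sum.cong) (auto simp: item_value_def)
  qed
  finally show ?thesis .
qed

lemma wf_scen: "k < N \<Longrightarrow> wf_scenario I (\<xi> k)"
  using wf by (simp add: wf_sramf_def)

text \<open>Each request has at least one passenger, so a hyperedge has no more requests than the
  capacity of its vehicle. The strict inequality leaves room for the vehicle as a further
  element.\<close>

lemma hyperedge_wf:
  assumes "k < N" "f \<in> hyperedges (\<xi> k)"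
  shows "fst f \<in> vehicles I" "finite (snd f)" "val (\<xi> k) f > 0" "card (snd f) < edge_bound I"
proof -
  obtain i R where f: "f = (i, R)" by fastforce
  have w: "finite (requests (\<xi> k))" "\<And>r. r \<in> requests (\<xi> k) \<Longrightarrow> passengers (\<xi> k) r \<ge> 1"
    "i \<in> vehicles I" "R \<subseteq> requests (\<xi> k)" "(\<Sum>r\<in>R. passengers (\<xi> k) r) \<le> capacity I i"
    "val (\<xi> k) (i, R) > 0"
    using wf_scen[OF assms(1)] assms(2) f unfolding wf_scenario_def by auto
  show "fst f \<in> vehicles I" "finite (snd f)" "val (\<xi> k) f > 0"
    using w f finite_subset by auto
  have "card R = (\<Sum>r\<in>R. 1)" by simp
  also have "\<dots> \<le> (\<Sum>r\<in>R. passengers (\<xi> k) r)" using w by (intro sum_mono) auto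
  also have "\<dots> \<le> capacity I i" by (rule w)
  also have "\<dots> \<le> Max (capacity I ` vehicles I)"
    using w wf by (intro Max_ge) (auto simp: wf_sramf_def vehicles_def)
  finally show "card (snd f) < edge_bound I" by (simp add: f edge_bound_def)
qed

lemma item_weight:
  assumes "F \<in> set (items t)"
  shows "2 ^ length (scale t) * item_value F \<le> 2 * real (weight t F)"
    "real (weight t F) \<le> 2 * (2 ^ length (scale t) * item_value F)"
proof -
  let ?q = "val (\<xi> (N - tag F)) (hyperedge_of F)"
  have pos: "?q > 0" using hyperedge_wf(3) item_index(1,3)[OF assms] by blast
  have "num_of F = nat_dat (nat (fst (quotient_of ?q)))" "den_of F = nat_dat (nat (snd (quotient_of ?q)))"
    using item_index(5)[OF assms] by (simp_all add: num_of_def den_of_def rat_dat_def)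
  from weight_bounds[OF assms this(1) of_rat_quotient(2)[OF pos] this(2) of_rat_quotient(3)[OF pos]]
  show "2 ^ length (scale t) * item_value F \<le> 2 * real (weight t F)"
    "real (weight t F) \<le> 2 * (2 ^ length (scale t) * item_value F)"
    unfolding item_value_def of_rat_quotient(1)[OF pos] .
qed

text \<open>Map each item of \<open>X\<close> in conflict with \<open>G\<close> to an element shared
  with \<open>G\<close>: \<open>None\<close> for the vehicle, \<open>Some r\<close> for a chosen
  common request. Two items with the same image share that element and lie in the same scenario, so
  they conflict and coincide. Likewise, two items of one vehicle that conflict with \<open>G\<close>
  lie in the scenario of \<open>G\<close> and conflict with each other.\<close>

lemma independent_item_degree:
  assumes X: "X \<subseteq> set (items t)" and indep: "\<And>F G. F \<in> X \<Longrightarrow> G \<in> X \<Longrightarrow> conflicts F G \<Longrightarrow> F = G"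
    and G: "G \<in> set (items t)"
  shows "card {F\<in>X. conflicts F G} \<le> edge_bound I"
    "card {F\<in>X. vehicle_of F = i \<and> conflicts F G} \<le> 1"
proof -
  let ?Y = "{F\<in>X. conflicts F G}"
  let ?R = "snd (hyperedge_of G)"
  define common where "common F = (if vehicle_of F = vehicle_of G then None
    else Some (SOME r. r \<in> snd (hyperedge_of F) \<inter> ?R))" for F
  have veh: "vehicle_of F = fst (hyperedge_of F)" for F
    by (simp add: vehicle_of_def hyperedge_of_def decode_edge_def)
  have mem: "(SOME r. r \<in> snd (hyperedge_of F) \<inter> ?R) \<in> snd (hyperedge_of F) \<inter> ?R"
    if "F \<in> ?Y" "vehicle_of F \<noteq> vehicle_of G" for F
  proof -
    have "\<exists>r. r \<in> snd (hyperedge_of F) \<inter> ?R"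
      using that by (auto simp: conflicts_iff disjoint_edges_def veh)
    then show ?thesis by (rule someI_ex)
  qed
  have "inj_on common ?Y"
  proof (rule inj_onI)
    fix F F' assume F: "F \<in> ?Y" "F' \<in> ?Y" and eq: "common F = common F'"
    have "\<not> disjoint_edges (hyperedge_of F) (hyperedge_of F')"
      using eq mem[OF F(1)] mem[OF F(2)]
      by (auto simp: common_def disjoint_edges_def veh split: if_splits)
    then have "conflicts F F'" using F by (auto simp: conflicts_iff)
    then show "F = F'" using indep F by blast
  qed
  moreover have "common ` ?Y \<subseteq> insert None (Some ` ?R)"
    using mem by (auto simp: common_def)
  moreover have fin: "finite ?R" and small: "card ?R < edge_bound I"
    using hyperedge_wf[OF item_index(1,3)[OF G]] by auto
  ultimately have "card ?Y \<le> card (insert None (Some ` ?R))" by (intro card_inj_on_le) auto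
  also have "\<dots> = Suc (card ?R)" using fin by (subst card_insert_disjoint) (auto simp: card_image)
  finally show "card ?Y \<le> edge_bound I" using small by simp
  have "F = F'" if "F \<in> {F\<in>X. vehicle_of F = i \<and> conflicts F G}"
    "F' \<in> {F\<in>X. vehicle_of F = i \<and> conflicts F G}" for F F'
    using that by (intro indep) (auto simp: conflicts_def)
  then show "card {F\<in>X. vehicle_of F = i \<and> conflicts F G} \<le> 1"
    using finite_subset[OF X finite_set] by (subst card_le_Suc0_iff_eq[unfolded One_nat_def[symmetric]]) auto
qed

text \<open>Both maxima range over finite sets that are nonempty because of the empty selection and
  the empty assignment, so they are attained.\<close>

lemma optimum:
  obtains S Os where "S \<subseteq> augmented I" "card S \<le> budget I"
    "\<And>k. k < N \<Longrightarrow> Os k \<in> assignments I S (\<xi> k)"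
    "sramf_opt I = (1 / real N) * (\<Sum>k<N. total_value (\<xi> k) (Os k))"
proof -
  let ?C = "{S. S \<subseteq> augmented I \<and> card S \<le> budget I}"
  have "finite ?C" using wf by (intro finite_subset[of ?C "Pow (augmented I)"]) (auto simp: wf_sramf_def)
  moreover have "{} \<in> ?C" by simp
  ultimately have "sramf_opt I \<in> average_opt I ` ?C"
    unfolding sramf_opt_def by (intro Max_in) blast+
  then obtain S where S: "S \<subseteq> augmented I" "card S \<le> budget I" "sramf_opt I = average_opt I S" by blast
  have "\<exists>M. M \<in> assignments I S (\<xi> k) \<and> scenario_opt I S (\<xi> k) = total_value (\<xi> k) M" if "k < N" for k
  proof -
    have "finite (Pow (hyperedges (\<xi> k)))" using wf_scen[OF that] by (simp add: wf_scenario_def)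
    moreover have "assignments I S (\<xi> k) \<subseteq> Pow (hyperedges (\<xi> k))" by (auto simp: assignments_def)
    ultimately have "finite (assignments I S (\<xi> k))" by (rule finite_subset[rotated])
    moreover have "{} \<in> assignments I S (\<xi> k)" by (simp add: assignments_def)
    ultimately have "scenario_opt I S (\<xi> k) \<in> total_value (\<xi> k) ` assignments I S (\<xi> k)"
      unfolding scenario_opt_def by (intro Max_in) blast+
    then show ?thesis by blast
  qed
  then have "\<forall>k\<in>{..<N}. \<exists>M. M \<in> assignments I S (\<xi> k) \<and> scenario_opt I S (\<xi> k) = total_value (\<xi> k) M"
    by simp
  from bchoice[OF this] obtain Os where Os: "\<forall>k\<in>{..<N}. Os k \<in> assignments I S (\<xi> k) \<and>
      scenario_opt I S (\<xi> k) = total_value (\<xi> k) (Os k)" by blast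
  show ?thesis
    by (rule that[OF S(1,2), of Os]) (use Os S(3) in \<open>auto simp: average_opt_def\<close>)
qed

theorem solve_correct:
  obtains S Ms where "solution_code S Ms (solve t)" "feasible_solution I S Ms"
    "sramf_opt I \<le> 32 * real (edge_bound I) * solution_value I Ms"
proof -
  obtain as bs where names: "distinct as" "set as = augmented I" "aug_names t = map nat_dat as"
    "set bs = basis I" "bas_names t = map nat_dat bs" "bound t = budget I" by (rule names)
  obtain S where S: "select t = map nat_dat S" "distinct S" "set S \<subseteq> set as"
    "length S = min (bound t) (length as)"
    "\<And>j i. j < length S \<Longrightarrow> i \<in> set as - set (take j S) \<Longrightarrow>
      gross t (map nat_dat (take j S @ [i])) \<le> gross t (map nat_dat (take (Suc j) S))"
    by (rule select_greedy[OF names(1,3)]) blast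
  let ?build = "foldl (add_vehicle (weight t) conflicts vehicle_of (items t)) []"
  define M where "M = ?build (bs @ S)"
  have M: "build t (select t) = M" unfolding S(1) build_eq_foldl[OF names(5)] M_def ..
  have conf_refl: "conflicts F F" and conf_sym: "conflicts F G \<Longrightarrow> conflicts G F" for F G
    by (auto simp: conflicts_def, metis+)
  let ?L = "concat (map (\<lambda>i. filter (\<lambda>F. vehicle_of F = i) (items t)) (bs @ S))"
  have M_eq: "M = foldl (insert_edge (weight t) conflicts) [] ?L"
    unfolding M_def by (rule foldl_add_vehicle)
  have "distinct M \<and> pairwise (\<lambda>F G. \<not> conflicts F G) (set M)"
    unfolding M_eq by (rule insert_edges_independent[OF conf_refl conf_sym]) simp_all
  then have indepM: "distinct M" "pairwise (\<lambda>F G. \<not> conflicts F G) (set M)" by auto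
  have setM: "set M \<subseteq> {F \<in> set (items t). vehicle_of F \<in> set bs \<union> set S}"
    using set_insert_edges[of "weight t" conflicts "[]" ?L] unfolding M_eq[symmetric] by auto
  have M_items: "F \<in> set (items t)" if "F \<in> set M" for F using setM that by blast
  define Mk where "Mk k = hyperedge_of ` {F \<in> set M. tag F = N - k}" for k
  define Ms where "Ms = map Mk [0..<N]"
  have Ms: "length Ms = N" "\<And>k. k < N \<Longrightarrow> Ms ! k = Mk k" by (simp_all add: Ms_def)
  have "solution_code (set S) Ms (solve t)"
    unfolding solution_code_def
  proof (intro exI conjI)
    show "solve t = Node (list_dat (select t)) (list_dat (map (\<lambda>s. list_dat (map edge_of
        (filter (\<lambda>F. tag F = length (els s)) M))) (suffixes (scens t))))"
      by (simp add: solve_def M)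
    show "set_code nat_code (set S) (list_dat (select t))"
      unfolding set_code_def S(1)
      by (intro exI[of _ S] exI[of _ "map nat_dat S"]) (simp add: S(2) nat_code_def list_all2_conv_all_nth)
    obtain ts where ts: "list_all2 scenario_code (scenarios I) ts" "scens t = list_dat ts"
      by (rule scens_code)
    have len: "length ts = N" using ts(1) by (simp add: list_all2_lengthD)
    have one: "set_code edge_code (Mk k) (list_dat (map edge_of (filter (\<lambda>F. tag F = N - k) M)))" for k
    proof -
      let ?K = "filter (\<lambda>F. tag F = N - k) M"
      have "inj_on hyperedge_of (set ?K)"
        by (rule inj_onI, rule item_inject) (simp_all add: M_items)
      then have "distinct (map hyperedge_of ?K)" using indepM by (simp add: distinct_map)
      moreover have "set (map hyperedge_of ?K) = Mk k" by (simp add: Mk_def)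
      moreover have "list_all2 edge_code (map hyperedge_of ?K) (map edge_of ?K)"
        by (simp add: list.rel_map list_all2_same item_index(4) M_items)
      ultimately show ?thesis unfolding set_code_def by blast
    qed
    show "list_code (set_code edge_code) Ms (list_dat (map (\<lambda>s. list_dat (map edge_of
        (filter (\<lambda>F. tag F = length (els s)) M))) (suffixes (scens t))))"
      unfolding list_code_def ts(2) suffixes_list_dat
      by (intro exI conjI refl) (auto simp: Ms_def len list.rel_map list_all2_same one)
  qed
  moreover have "feasible_solution I (set S) Ms"
    unfolding feasible_solution_def
  proof (intro conjI allI impI)
    show "set S \<subseteq> augmented I" using S names by simp
    show "card (set S) \<le> budget I" using S names by (simp add: distinct_card)
    show "length Ms = N" by (rule Ms)
    fix k assume k: "k < N"
    have "Mk k \<subseteq> hyperedges (\<xi> k)"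
      using items_spec(2)[OF k] setM by (auto simp: Mk_def bij_betw_def)
    moreover have "pairwise disjoint_edges (Mk k)"
      using indepM(2) by (auto simp: pairwise_def Mk_def conflicts_iff) metis
    moreover have "fst f \<notin> augmented I - set S" if "f \<in> Mk k" for f
    proof -
      obtain F where F: "F \<in> set M" "f = hyperedge_of F" using \<open>f \<in> Mk k\<close> by (auto simp: Mk_def)
      then have "fst f \<in> set bs \<union> set S"
        using setM by (auto simp: vehicle_of_def hyperedge_of_def decode_edge_def)
      then show ?thesis using names wf by (auto simp: wf_sramf_def)
    qed
    ultimately show "Ms ! k \<in> assignments I (set S) (\<xi> k)" using Ms(2)[OF k] by (simp add: assignments_def)
  qed
  moreover have "sramf_opt I \<le> 32 * real (edge_bound I) * solution_value I Ms"
  proof -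
    obtain T Os where T: "T \<subseteq> augmented I" "card T \<le> budget I"
      and Os: "\<And>k. k < N \<Longrightarrow> Os k \<in> assignments I T (\<xi> k)"
      and opt: "sramf_opt I = (1 / real N) * (\<Sum>k<N. total_value (\<xi> k) (Os k))" by (rule optimum) blast
    \<comment> \<open>The optimal assignments of all scenarios, pulled back to items.\<close>
    define X where "X = {F \<in> set (items t). hyperedge_of F \<in> Os (N - tag F)}"
    have X: "X \<subseteq> set (items t)" "finite X" by (auto simp: X_def)
    have indepX: "F = G" if "F \<in> X" "G \<in> X" "conflicts F G" for F G
    proof -
      have it: "F \<in> set (items t)" "G \<in> set (items t)" "tag F = tag G"
        and nd: "\<not> disjoint_edges (hyperedge_of F) (hyperedge_of G)"
        using that by (auto simp: X_def conflicts_iff)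
      have "pairwise disjoint_edges (Os (N - tag F))"
        using Os[OF item_index(1)[OF it(1)]] by (simp add: assignments_def)
      then have "hyperedge_of F = hyperedge_of G"
        using that it(3) nd by (auto simp: X_def pairwise_def)
      then show ?thesis using item_inject it by blast
    qed
    have veX: "vehicle_of ` X \<subseteq> set bs \<union> T"
    proof
      fix i assume "i \<in> vehicle_of ` X"
      then obtain F where F: "F \<in> set (items t)" "hyperedge_of F \<in> Os (N - tag F)" "i = vehicle_of F"
        by (auto simp: X_def)
      have i: "i = fst (hyperedge_of F)"
        by (simp add: F vehicle_of_def hyperedge_of_def decode_edge_def)
      have "i \<in> vehicles I" unfolding i using hyperedge_wf(1) item_index(1,3)[OF F(1)] by blast
      moreover have "i \<notin> augmented I - T"
        unfolding i using Os[OF item_index(1)[OF F(1)]] F(2) by (auto simp: assignments_def)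
      ultimately show "i \<in> set bs \<union> T" using names by (auto simp: vehicles_def)
    qed
    have cardX: "card (vehicle_of ` X \<inter> set as) \<le> budget I"
    proof -
      have sub: "vehicle_of ` X \<inter> set as \<subseteq> T"
        using veX names wf by (auto simp: wf_sramf_def)
      have "finite T" using finite_subset[OF T(1)] wf by (simp add: wf_sramf_def)
      from card_mono[OF this sub] show ?thesis using T(2) by linarith
    qed
    have "(\<Sum>F\<in>X. weight t F) \<le> 8 * edge_bound I * (\<Sum>F\<leftarrow>?build (bs @ S). weight t F)"
    proof (rule greedy_vehicles_bound[where A = "set as" and K = "budget I"])
      show "conflicts F F" for F by (rule conf_refl)
      show "finite X" "X \<subseteq> set (items t)" by (rule X)+
      show "card {F\<in>X. conflicts F G} \<le> edge_bound I" if "G \<in> set (items t)" for G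
        by (rule independent_item_degree(1)[OF X(1) indepX that])
      show "card {F\<in>X. vehicle_of F = i \<and> conflicts F G} \<le> 1" if "G \<in> set (items t)" for G i
        by (rule independent_item_degree(2)[OF X(1) indepX that])
      show "vehicle_of ` X \<subseteq> set bs \<union> set as" using veX T names by auto
      show "length S = min (budget I) (card (set as))"
        by (simp only: S(4) names(6) distinct_card[OF names(1)])
      show "(\<Sum>F\<leftarrow>?build (bs @ take j S @ [i]). weight t F) \<le> (\<Sum>F\<leftarrow>?build (bs @ take (Suc j) S). weight t F)"
        if "j < length S" "i \<in> set as - set (take j S)" for j i
        using S(5)[OF that] unfolding gross_def build_eq_foldl[OF names(5)] .
    qed (use S cardX edge_bound_ge_2[OF wf] in auto)
    then have w: "(\<Sum>F\<in>X. weight t F) \<le> 8 * edge_bound I * (\<Sum>F\<in>set M. weight t F)"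
      using indepM(1) by (simp add: M_def sum_list_distinct_conv_sum_set)
    let ?c = "2 ^ length (scale t) :: real"
    \<comment> \<open>The constant 32 is 2 * 8 * 2: a rounding factor of two for the optimum, the
      greedy bound, and a rounding factor of two for the computed solution. The common scale
      \<open>?c\<close> cancels at the end.\<close>
    have "?c * (\<Sum>F\<in>X. item_value F) \<le> 2 * (\<Sum>F\<in>X. real (weight t F))"
      unfolding sum_distrib_left using X item_weight(1) by (intro sum_mono) auto
    also have "\<dots> = 2 * real (\<Sum>F\<in>X. weight t F)" by simp
    also have "\<dots> \<le> 2 * real (8 * edge_bound I * (\<Sum>F\<in>set M. weight t F))"
      using w by (intro mult_left_mono of_nat_mono) simp_all
    also have "\<dots> = 16 * real (edge_bound I) * (\<Sum>F\<in>set M. real (weight t F))" by simp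
    also have "\<dots> \<le> 16 * real (edge_bound I) * (\<Sum>F\<in>set M. 2 * (?c * item_value F))"
      using setM item_weight(2) by (intro mult_left_mono sum_mono) auto
    also have "\<dots> = 16 * real (edge_bound I) * (2 * (?c * (\<Sum>F\<in>set M. item_value F)))"
      by (simp only: sum_distrib_left)
    also have "\<dots> = ?c * (32 * real (edge_bound I) * (\<Sum>F\<in>set M. item_value F))" by simp
    finally have "(\<Sum>F\<in>X. item_value F) \<le> 32 * real (edge_bound I) * (\<Sum>F\<in>set M. item_value F)"
      by simp
    moreover have "(\<Sum>F\<in>X. item_value F) = (\<Sum>k<N. total_value (\<xi> k) (Os k))"
    proof -
      have "hyperedge_of ` {F\<in>X. tag F = N - k} = Os k" if k: "k < N" for k
      proof
        show "hyperedge_of ` {F\<in>X. tag F = N - k} \<subseteq> Os k" using k by (auto simp: X_def)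
        have "Os k \<subseteq> hyperedge_of ` {F\<in>set (items t). tag F = N - k}"
          using Os[OF k] items_spec(2)[OF k] by (auto simp: bij_betw_def assignments_def)
        then show "Os k \<subseteq> hyperedge_of ` {F\<in>X. tag F = N - k}" using k by (fastforce simp: X_def)
      qed
      then show ?thesis using sum_item_value[OF X(1)] by simp
    qed
    moreover have "(\<Sum>F\<in>set M. item_value F) = (\<Sum>k<N. total_value (\<xi> k) (Ms ! k))"
      using sum_item_value[of "set M"] setM by (auto simp: Ms Mk_def)
    ultimately have "(\<Sum>k<N. total_value (\<xi> k) (Os k)) \<le>
        32 * real (edge_bound I) * (\<Sum>k<N. total_value (\<xi> k) (Ms ! k))" by simp
    then show ?thesis unfolding opt solution_value_def
      by (simp add: divide_right_mono)
  qed
  ultimately show ?thesis by (rule that)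
qed

end

section \<open>From the ratio \<open>1 / (32 * p)\<close> to the stated one\<close>

lemma solve_polytime_approximation:
  assumes "\<And>I. wf_sramf I \<Longrightarrow> \<rho> I \<le> 1 / (32 * real (edge_bound I))"
  shows "\<exists>c. polytime_approximation c \<rho>"
proof -
  obtain b where b: "pbounded b" and "\<forall>k. \<exists>c. \<forall>s. \<exists>n s'.
     exec c s n s' \<and> n \<le> b (size (s 0)) \<and> s' 0 = solve (s 0) \<and> (\<forall>j\<in>{1..k}. s' j = s j)"
    using PT_solve unfolding PT_def by blast
  then obtain c where c: "\<And>s. \<exists>n s'. exec c s n s' \<and> n \<le> b (size (s 0)) \<and> s' 0 = solve (s 0)"
    by metis
  obtain q :: "nat poly" where q: "\<And>n. b n \<le> poly q n" using b unfolding pbounded_def by blast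
  have "\<exists>n out S Ms. runs c t n out \<and> n \<le> poly q (size t) \<and> solution_code S Ms out \<and>
      feasible_solution I S Ms \<and> solution_value I Ms \<ge> \<rho> I * sramf_opt I"
    if "wf_sramf I" "sramf_code I t" for I t
  proof -
    interpret encoded_sramf I t by unfold_locales fact+
    obtain S Ms where S: "solution_code S Ms (solve t)" "feasible_solution I S Ms"
      "sramf_opt I \<le> 32 * real (edge_bound I) * solution_value I Ms" by (rule solve_correct)
    obtain n s' where "exec c ((\<lambda>_. Leaf)(0 := t)) n s'" "n \<le> b (size t)" "s' 0 = solve t"
      using c[of "(\<lambda>_. Leaf)(0 := t)"] by auto
    then have "runs c t n (solve t)" "n \<le> poly q (size t)"
      using q order_trans unfolding runs_def by blast+
    moreover have "\<rho> I * sramf_opt I \<le> solution_value I Ms"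
    proof -
      obtain T Os where Os: "\<And>k. k < N \<Longrightarrow> Os k \<in> assignments I T (\<xi> k)"
        and opt: "sramf_opt I = (1 / real N) * (\<Sum>k<N. total_value (\<xi> k) (Os k))" by (rule optimum) blast
      \<comment> \<open>The assumption bounds \<open>\<rho> I\<close> only from above, so replacing
        it by \<open>1 / (32 * p)\<close> in the product requires a nonnegative optimum.\<close>
      have "0 \<le> total_value (\<xi> k) (Os k)" if "k < N" for k
        unfolding total_value_def
        using Os[OF that] hyperedge_wf(3)[OF that]
        by (intro sum_nonneg) (auto simp: assignments_def intro: less_imp_le)
      then have "0 \<le> sramf_opt I" unfolding opt by (intro mult_nonneg_nonneg sum_nonneg) auto
      then have "\<rho> I * sramf_opt I \<le> 1 / (32 * real (edge_bound I)) * sramf_opt I"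
        by (rule mult_right_mono[OF assms[OF wf]])
      also have "\<dots> \<le> solution_value I Ms"
        using S(3) edge_bound_ge_2[OF wf] by (simp add: field_simps)
      finally show ?thesis .
    qed
    ultimately show ?thesis using S by blast
  qed
  then show ?thesis unfolding polytime_approximation_def by blast
qed

theorem mainTheorem2:
  "\<exists>h :: nat \<Rightarrow> real. h \<longlonglongrightarrow> 0 \<and> (\<forall>p\<ge>2. 2 * exp 1 + h p > 0) \<and>
     (\<exists>c. polytime_approximation c
        (\<lambda>I. (exp 1 - 1) /
          ((2 * exp 1 + h (edge_bound I)) * real (edge_bound I) * ln (real (edge_bound I)))))"
proof -
  \<comment> \<open>\<open>32 * (exp 1 - 1) / ln p\<close> is the value that
    \<open>2 * exp 1 + h p\<close> has to reach for the claimed ratio to be at most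
    \<open>1 / (32 * p)\<close>. The function \<open>h\<close> supplies what is missing for small
    \<open>p\<close> and vanishes as soon as \<open>ln p\<close> is at least 32.\<close>
  define h :: "nat \<Rightarrow> real" where "h p = max 0 (32 * (exp 1 - 1) / ln (real p) - 2 * exp 1)" for p
  have "eventually (\<lambda>p. 32 \<le> ln (real p)) sequentially"
    using filterlim_compose[OF ln_at_top filterlim_real_sequentially] by (simp add: filterlim_at_top)
  then have "eventually (\<lambda>p. h p = 0) sequentially"
  proof eventually_elim
    case (elim p)
    have "32 * (exp 1 - 1) / ln (real p) \<le> 32 * (exp 1 - 1) / 32"
      using elim by (intro divide_left_mono) auto
    also have "\<dots> = exp 1 - 1" by simp
    also have "\<dots> \<le> 2 * exp (1::real)" using exp_gt_zero[of "1::real"] by linarith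
    finally show ?case by (simp add: h_def)
  qed
  then have "h \<longlonglongrightarrow> 0" by (rule tendsto_eventually)
  moreover have pos: "2 * exp 1 + h p > 0" for p
    using exp_gt_zero[of "1::real"] by (simp add: h_def add_pos_nonneg)
  moreover have "\<exists>c. polytime_approximation c (\<lambda>I. (exp 1 - 1) /
      ((2 * exp 1 + h (edge_bound I)) * real (edge_bound I) * ln (real (edge_bound I))))"
  proof (rule solve_polytime_approximation)
    fix I assume "wf_sramf I"
    define p where "p = edge_bound I"
    have p: "2 \<le> p" using edge_bound_ge_2[OF \<open>wf_sramf I\<close>] by (simp add: p_def)
    then have ln: "ln (real p) > 0" by simp
    let ?D = "(2 * exp 1 + h p) * real p * ln (real p)"
    have "32 * (exp 1 - 1) / ln (real p) \<le> 2 * exp 1 + h p" by (simp add: h_def)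
    then have "32 * (exp 1 - 1) \<le> (2 * exp 1 + h p) * ln (real p)"
      using ln by (simp add: pos_divide_le_eq)
    then have "real p * (32 * (exp 1 - 1)) \<le> real p * ((2 * exp 1 + h p) * ln (real p))"
      by (rule mult_left_mono) simp
    then have "(exp 1 - 1) * (32 * real p) \<le> ?D" by (simp only: mult_ac)
    then have "exp 1 - 1 \<le> ?D / (32 * real p)" using p by (subst pos_le_divide_eq) simp_all
    moreover have "0 < ?D" using pos[of p] p ln by simp
    ultimately have "(exp 1 - 1) / ?D \<le> 1 / (32 * real p)" by (subst pos_divide_le_eq) simp_all
    then show "(exp 1 - 1) / ((2 * exp 1 + h (edge_bound I)) * real (edge_bound I) *
        ln (real (edge_bound I))) \<le> 1 / (32 * real (edge_bound I))"
      by (simp only: p_def)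
  qed
  ultimately show ?thesis by blast
qed

end
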